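(* The function $v$ is convex and differentiable on $\mathrm{int}(P)$, with gradient given by $\nabla v(x)=(n+1)\,c(x)$.
   Context: $P=\{x\in\mathbb R^n: a_i^\top x\le 1,\ i=1,\dots,m\}$ is a full-dimensional (bounded) polytope. For $c\in\mathbb R^n$ and $Q$ symmetric positive definite, $\mathcal E(c,Q)=\{y\in\mathbb R^n:(y-c)^\top Q(y-c)\le 1\}$, with normalized volume $\mathrm{Vol}(\mathcal E(c,Q))=\det(Q)^{-1/2}$. The polar of $S$ is $S^\circ=\{y: y^\top s\le1\ \forall s\in S\}$. $\mathrm{MinCE}(K)$ is the unique minimum-volume ellipsoid containing a full-dimensional compact set $K$. For $x\in\mathrm{int}(P)$ write $\mathrm{MinCE}((P-x)^\circ)=\mathcal E(c(x),Q(x))$ and $v(x)=\log\mathrm{Vol}(\mathrm{MinCE}((P-x)^\circ))$. *)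

theory Defs
  imports "HOL-Analysis.Analysis"
begin

definition posdef :: "real ^ 'n ^ 'n \<Rightarrow> bool" where
  "posdef Q \<longleftrightarrow> transpose Q = Q \<and> (\<forall>x. x \<noteq> 0 \<longrightarrow> x \<bullet> (Q *v x) > 0)"

definition ellipsoid :: "real ^ 'n \<Rightarrow> real ^ 'n ^ 'n \<Rightarrow> (real ^ 'n) set" where
  "ellipsoid c Q = {y. (y - c) \<bullet> (Q *v (y - c)) \<le> 1}"

definition is_ellipsoid :: "(real ^ 'n) set \<Rightarrow> bool" where
  "is_ellipsoid E \<longleftrightarrow> (\<exists>c Q. posdef Q \<and> E = ellipsoid c Q)"

(* An ellipsoid determines its center and its positive definite matrix; the lemmas
   ellipsoid_center_ellipsoid and ellipsoid_matrix_ellipsoid below show that these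
   descriptions are well defined. *)
definition ellipsoid_center :: "(real ^ 'n) set \<Rightarrow> real ^ 'n" where
  "ellipsoid_center E = (THE c. \<exists>Q. posdef Q \<and> E = ellipsoid c Q)"

definition ellipsoid_matrix :: "(real ^ 'n) set \<Rightarrow> real ^ 'n ^ 'n" where
  "ellipsoid_matrix E = (THE Q. posdef Q \<and> (\<exists>c. E = ellipsoid c Q))"

(* Normalized volume: the unit ball has volume 1. *)
definition Vol :: "(real ^ 'n) set \<Rightarrow> real" where
  "Vol E = det (ellipsoid_matrix E) powr (- 1 / 2)"

definition polar :: "(real ^ 'n) set \<Rightarrow> (real ^ 'n) set" where
  "polar S = {y. \<forall>s\<in>S. y \<bullet> s \<le> 1}"

definition is_MinCE :: "(real ^ 'n) set \<Rightarrow> (real ^ 'n) set \<Rightarrow> bool" where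
  "is_MinCE K E \<longleftrightarrow> is_ellipsoid E \<and> K \<subseteq> E \<and>
     (\<forall>E'. is_ellipsoid E' \<and> K \<subseteq> E' \<longrightarrow> Vol E \<le> Vol E')"

definition MinCE :: "(real ^ 'n) set \<Rightarrow> (real ^ 'n) set" where
  "MinCE K = (THE E. is_MinCE K E)"

definition MinCE_polar :: "(real ^ 'n) set \<Rightarrow> real ^ 'n \<Rightarrow> (real ^ 'n) set" where
  "MinCE_polar P x = MinCE (polar ((\<lambda>p. p - x) ` P))"

lemma ellipsoid_eq_imp_center_eq:
  fixes c c' :: "real ^ 'n"
  assumes Q: "posdef Q" and E: "ellipsoid c Q = ellipsoid c' Q'"
  shows "c = c'"
proof (rule ccontr)
  assume ne: "c \<noteq> c'"
  define w where "w = c' - c"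
  have refl: "2 *\<^sub>R b - y \<in> ellipsoid b R" if "y \<in> ellipsoid b R" for b y :: "real ^ 'n" and R
  proof -
    have "2 *\<^sub>R b - y - b = - (y - b)" by (simp add: scaleR_2)
    then have "(2 *\<^sub>R b - y - b) \<bullet> (R *v (2 *\<^sub>R b - y - b)) = (y - b) \<bullet> (R *v (y - b))"
      by (simp only: linear_neg[OF matrix_vector_mul_linear] inner_minus_left inner_minus_right minus_minus)
    then show ?thesis using that by (simp add: ellipsoid_def)
  qed
  have step: "y + 2 *\<^sub>R w \<in> ellipsoid c Q" if "y \<in> ellipsoid c Q" for y
  proof -
    have "2 *\<^sub>R c' - (2 *\<^sub>R c - y) \<in> ellipsoid c Q"
      using refl[OF that] refl E by blast
    then show ?thesis by (simp add: w_def algebra_simps)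
  qed
  have mem: "c + (2 * real k) *\<^sub>R w \<in> ellipsoid c Q" for k
  proof (induction k)
    case 0 then show ?case by (simp add: ellipsoid_def)
  next
    case (Suc k)
    from step[OF this] show ?case by (simp add: algebra_simps)
  qed
  define q where "q = w \<bullet> (Q *v w)"
  have q: "q > 0" using Q ne by (simp add: q_def posdef_def w_def)
  obtain k :: nat where k: "real k > 1 / q" using reals_Archimedean2 by blast
  have "(2 * real k) * ((2 * real k) * q) \<le> 1"
    using mem[of k]
    by (simp add: ellipsoid_def q_def linear_scale[OF matrix_vector_mul_linear] mult.assoc)
  moreover have "real k * q > 1" using k q by (simp add: field_simps)
  moreover have "real k \<ge> 1" using \<open>real k * q > 1\<close> by (cases k) auto
  ultimately show False
    using mult_mono[of 1 "real k" 1 "real k * q"] by (simp add: algebra_simps)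
qed

lemma ellipsoid_eq_imp_matrix_eq:
  fixes c :: "real ^ 'n"
  assumes Q: "posdef Q" and Q': "posdef Q'" and E: "ellipsoid c Q = ellipsoid c Q'"
  shows "Q = Q'"
proof -
  have le: "h \<bullet> (B *v h) \<le> h \<bullet> (A *v h)"
    if A: "posdef A" and EAB: "ellipsoid c A = ellipsoid c B" for A B :: "real ^ 'n ^ 'n" and h :: "real ^ 'n"
  proof (cases "h = 0")
    case False
    define q where "q = h \<bullet> (A *v h)"
    have q: "q > 0" using A False by (simp add: q_def posdef_def)
    have sc: "(r *\<^sub>R h) \<bullet> (M *v (r *\<^sub>R h)) = r\<^sup>2 * (h \<bullet> (M *v h))" for r and M :: "real ^ 'n ^ 'n"
      by (simp add: linear_scale[OF matrix_vector_mul_linear] power2_eq_square mult.assoc)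
    have r: "(1 / sqrt q)\<^sup>2 = 1 / q" using q by (simp add: power_divide)
    have "c + (1 / sqrt q) *\<^sub>R h \<in> ellipsoid c A"
      unfolding ellipsoid_def using q sc[of "1 / sqrt q" A, unfolded r] by (simp add: q_def)
    then have "c + (1 / sqrt q) *\<^sub>R h \<in> ellipsoid c B" using EAB by simp
    then have "1 / q * (h \<bullet> (B *v h)) \<le> 1"
      unfolding ellipsoid_def using sc[of "1 / sqrt q" B, unfolded r] by simp
    then show ?thesis using q by (simp add: field_simps q_def)
  qed simp
  have eq: "h \<bullet> (Q *v h) = h \<bullet> (Q' *v h)" for h
    using le[OF Q E] le[OF Q' E[symmetric]] by (meson antisym)
  have sym: "u \<bullet> (M *v w) = w \<bullet> (M *v u)" if "posdef M" for M :: "real ^ 'n ^ 'n" and u w :: "real ^ 'n"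
    using that by (metis dot_lmul_matrix inner_commute posdef_def vector_transpose_matrix)
  have "u \<bullet> (Q *v w) = u \<bullet> (Q' *v w)" for u w
    using eq[of "u + w"] eq[of u] eq[of w] sym[OF Q, of u w] sym[OF Q', of u w]
    by (simp add: matrix_vector_right_distrib inner_add_left inner_add_right)
  then have "Q *v w = Q' *v w" for w
    by (metis vector_eq_rdot inner_commute)
  then show ?thesis by (simp add: matrix_eq)
qed

lemma ellipsoid_center_ellipsoid: "posdef Q \<Longrightarrow> ellipsoid_center (ellipsoid c Q) = c"
  unfolding ellipsoid_center_def
  by (rule the_equality) (use ellipsoid_eq_imp_center_eq in blast)+

lemma ellipsoid_matrix_ellipsoid: "posdef Q \<Longrightarrow> ellipsoid_matrix (ellipsoid c Q) = Q"
  unfolding ellipsoid_matrix_def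
  by (rule the_equality)
    (blast, metis ellipsoid_eq_imp_center_eq ellipsoid_eq_imp_matrix_eq)

lemma Vol_ellipsoid: "posdef Q \<Longrightarrow> Vol (ellipsoid c Q) = det Q powr (- 1 / 2)"
  by (simp add: Vol_def ellipsoid_matrix_ellipsoid)

end

theory Submission
  imports Defs
begin

text \<open>For \<open>x\<close> in the interior of \<open>P\<close>, the polar of \<open>P - x\<close> is the convex hull of the points
  \<open>a\<^sub>i / (1 - a\<^sub>i \<bullet> x)\<close>, and passing from \<open>x\<close> to \<open>x + h\<close> moves them by the projective map
  \<open>p \<mapsto> p / (1 - p \<bullet> h)\<close>. Maximising the determinant of the covariance of a probability
  distribution on these points produces the minimum ellipsoid \<open>E(c, Q)\<close> together with an optimal
  dual solution: weights with barycentre \<open>c\<close> and covariance \<open>Q\<^sup>-\<^sup>1 / n\<close>. Testing an ellipsoid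
  \<open>E(c', Q')\<close> that contains the moved points against these weights gives
  \<open>det Q' \<le> det Q (1 - c \<bullet> h)\<^bsup>2(n + 1)\<^esup>\<close>, that is,
  \<open>v (x + h) \<ge> v x - (n + 1) ln (1 - c \<bullet> h) \<ge> v x + (n + 1) c \<bullet> h\<close>. So \<open>(n + 1) c\<close> is a subgradient at
  every interior point, and \<open>v\<close> is convex. Conversely, \<open>E(c, Q)\<close> is moved into an explicit ellipsoid
  whose logarithmic volume is \<open>v x + (n + 1) c \<bullet> h\<close> to first order; squeezed between the two bounds,
  \<open>v\<close> is differentiable with this gradient.\<close>

section \<open>Outer products and determinants\<close>

declare transpose_matrix_vector [simp del]

definition outer :: "real ^ 'n \<Rightarrow> real ^ 'n \<Rightarrow> real ^ 'n ^ 'n" where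
  "outer u v = (\<chi> i j. u $ i * v $ j)"

lemma outer_mult_vec [simp]: "outer u v *v x = (v \<bullet> x) *\<^sub>R u"
  by (simp add: outer_def matrix_vector_mult_def vec_eq_iff inner_vec_def sum_distrib_right
      sum_distrib_left mult_ac)

lemma mult_outer: "A ** outer u v = outer (A *v u) v"
  by (simp add: matrix_eq matrix_vector_mult_scaleR flip: matrix_vector_mul_assoc)

lemma transpose_outer: "transpose (outer u v) = outer v u"
  by (simp add: outer_def transpose_def mult.commute)

lemma inner_transpose: "x \<bullet> (transpose A *v y) = (A *v x) \<bullet> (y :: real ^ 'n)"
  by (metis dot_lmul_matrix inner_commute transpose_matrix_vector)

lemma outer_mult: "outer u v ** A = outer u (transpose A *v v)"
  by (simp add: matrix_eq dot_lmul_matrix transpose_matrix_vector flip: matrix_vector_mul_assoc)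

lemma outer_scaleR_left: "outer (r *\<^sub>R u) v = r *\<^sub>R outer u v"
  by (simp add: outer_def vec_eq_iff)

lemma outer_scaleR_right: "outer u (r *\<^sub>R v) = r *\<^sub>R outer u v"
  by (simp add: outer_def vec_eq_iff)

lemma trace_outer: "trace (outer u v) = u \<bullet> v"
  by (simp add: trace_def outer_def inner_vec_def)

lemma trace_scaleR: "trace (r *\<^sub>R A) = r * trace (A :: real ^ 'n ^ 'n)"
  by (simp add: trace_def sum_distrib_left)

lemma trace_sum: "trace (\<Sum>i\<in>I. f i) = (\<Sum>i\<in>I. trace (f i :: real ^ 'n ^ 'n))"
  unfolding trace_def sum_component by (rule sum.swap)

lemma scaleR_mult_matrix: "(r *\<^sub>R A) ** B = r *\<^sub>R (A ** (B :: real ^ 'n ^ 'n))"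
  by (simp add: matrix_eq flip: matrix_vector_mul_assoc scaleR_matrix_vector_assoc)

lemma mult_scaleR_matrix: "A ** (r *\<^sub>R B) = r *\<^sub>R (A ** (B :: real ^ 'n ^ 'n))"
  by (simp add: matrix_eq matrix_vector_mult_scaleR flip: matrix_vector_mul_assoc scaleR_matrix_vector_assoc)

lemma add_mult_matrix: "(A + B) ** C = A ** C + B ** (C :: real ^ 'n ^ 'n)"
  by (simp add: matrix_eq matrix_vector_mult_add_rdistrib flip: matrix_vector_mul_assoc)

lemma mult_sum_matrix: "A ** (\<Sum>i\<in>I. f i) = (\<Sum>i\<in>I. A ** (f i :: real ^ 'n ^ 'n))"
  by (induction I rule: infinite_finite_induct) (simp_all add: matrix_add_ldistrib)

lemma sum_mult_vec: "(\<Sum>i\<in>I. f i) *v x = (\<Sum>i\<in>I. (f i :: real ^ 'n ^ 'n) *v x)"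
  by (induction I rule: infinite_finite_induct) (simp_all add: matrix_vector_mult_add_rdistrib)

lemma transpose_scaleR: "transpose (r *\<^sub>R A) = r *\<^sub>R transpose (A :: real ^ 'n ^ 'n)"
  by (simp add: transpose_def vec_eq_iff)

lemma transpose_sum: "transpose (\<Sum>i\<in>I. f i) = (\<Sum>i\<in>I. transpose (f i :: real ^ 'n ^ 'n))"
  by (simp add: transpose_def vec_eq_iff)

lemma det_scaleR: "det (r *\<^sub>R A) = r ^ CARD('n) * det (A :: real ^ 'n ^ 'n)"
proof -
  have "r *\<^sub>R A = (\<chi> i. r *s A $ i)" by (simp add: vec_eq_iff)
  then show ?thesis using det_rows_mul[of "\<lambda>_. r" "\<lambda>i. A $ i"] by (simp add: vec_lambda_eta)
qed

text \<open>Only column \<open>k\<close> differs from the identity, so this is Cramer's rule for the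
  identity matrix and the vector \<open>axis k 1 + w\<close>.\<close>

lemma det_one_plus_outer_axis: "det (mat 1 + outer w (axis k 1)) = 1 + (w :: real ^ 'n) $ k"
proof -
  have "mat 1 + outer w (axis k 1) =
      (\<chi> i j. if j = k then ((mat 1 :: real ^ 'n ^ 'n) *v (axis k 1 + w)) $ i else mat 1 $ i $ j)"
    by (simp only: matrix_vector_mul_lid) (auto simp: vec_eq_iff outer_def mat_def axis_def)
  then show ?thesis
    by (simp only: cramer_lemma) (simp add: axis_def)
qed

text \<open>The rank-one matrix determinant lemma. An orthogonal change of basis turns
  \<open>v\<close> into a multiple of a coordinate axis, which is the preceding case.\<close>

lemma det_one_plus_outer: "det (mat 1 + outer u v) = 1 + u \<bullet> (v :: real ^ 'n)"
proof (cases "v = 0")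
  case True
  then have "outer u v = 0" by (simp add: outer_def vec_eq_iff)
  then show ?thesis using True by simp
next
  case False
  define b where "b = v /\<^sub>R norm v"
  have v: "v = norm v *\<^sub>R b" and "norm b = 1" using False by (simp_all add: b_def)
  then obtain A k where A: "orthogonal_matrix A" "A *v (axis k 1) = b"
    using orthogonal_matrix_exists_basis by metis
  have AA: "transpose A ** A = mat 1" "A ** transpose A = mat 1"
    using A by (auto simp: orthogonal_matrix_def)
  have Ab: "transpose A *v b = axis k 1"
    using AA A(2) by (metis matrix_vector_mul_assoc matrix_vector_mul_lid)
  let ?w = "transpose A *v (norm v *\<^sub>R u)"
  have "transpose A ** (mat 1 + outer u v) ** A = mat 1 + outer ?w (axis k 1)"
    by (subst v, simp add: matrix_add_ldistrib add_mult_matrix mult_outer outer_mult AA Ab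
        outer_scaleR_left outer_scaleR_right matrix_vector_mult_scaleR scaleR_mult_matrix mult_scaleR_matrix)
  moreover have "det (transpose A) * det A = 1"
    using AA(1) by (metis det_I det_mul)
  ultimately have "det (mat 1 + outer u v) = det (mat 1 + outer ?w (axis k 1))"
    by (metis (no_types, lifting) det_mul mult.assoc mult.commute mult.left_neutral)
  also have "\<dots> = 1 + axis k 1 \<bullet> ?w"
    by (simp add: det_one_plus_outer_axis inner_axis')
  also have "\<dots> = 1 + u \<bullet> v"
    by (subst v) (simp add: inner_transpose A inner_commute)
  finally show ?thesis .
qed

section \<open>Symmetric and positive definite matrices\<close>

lemma symmetric_inner: "transpose A = A \<Longrightarrow> x \<bullet> (A *v y) = (A *v x) \<bullet> (y :: real ^ 'n)"
  by (metis inner_transpose)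

text \<open>Induction on the dimension: split off a unit eigenvector \<open>u\<close>; by
  self-adjointness its orthogonal complement inside \<open>V\<close> is invariant again.\<close>

lemma selfadjoint_eigenbasis:
  fixes f :: "'a :: euclidean_space \<Rightarrow> 'a"
  assumes f: "linear f" "\<And>x y. x \<bullet> f y = f x \<bullet> y"
  shows "subspace V \<Longrightarrow> f ` V \<subseteq> V \<Longrightarrow>
    \<exists>B. pairwise orthogonal B \<and> (\<forall>b\<in>B. norm b = 1 \<and> (\<exists>l. f b = l *\<^sub>R b)) \<and> span B = V"
proof (induction "dim V" arbitrary: V rule: less_induct)
  case less
  interpret linear f by fact
  show ?case
  proof (cases "V = {0}")
    case True
    then show ?thesis by (intro exI[of _ "{}"]) simp
  next
    case False
    \<comment> \<open>A maximiser of the Rayleigh quotient on \<open>V\<close> is an eigenvector.\<close>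
    let ?S = "V \<inter> sphere 0 1"
    obtain x where x: "x \<in> V" "x \<noteq> 0" using False subspace_0[OF less.prems(1)] by auto
    then have "x /\<^sub>R norm x \<in> ?S"
      using subspace_scale[OF less.prems(1)] by simp
    moreover have "compact ?S"
      using closed_subspace[OF less.prems(1)] by (simp add: closed_Int_compact)
    moreover have "continuous_on ?S (\<lambda>x. x \<bullet> f x)"
      by (intro continuous_intros linear_continuous_on linear_conv_bounded_linear[THEN iffD1] f)
    ultimately obtain u where u: "u \<in> ?S" "\<And>y. y \<in> ?S \<Longrightarrow> y \<bullet> f y \<le> u \<bullet> f u"
      using continuous_attains_sup[of ?S "\<lambda>x. x \<bullet> f x"] by blast
    define l where "l = u \<bullet> f u"
    have uV: "u \<in> V" "norm u = 1" using u by auto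
    have uu: "u \<bullet> u = 1" using uV by (simp add: dot_square_norm)
    have le: "y \<bullet> f y \<le> l * (y \<bullet> y)" if "y \<in> V" for y
    proof (cases "y = 0")
      case False
      have "y /\<^sub>R norm y \<in> ?S" using False that subspace_scale[OF less.prems(1)] by simp
      from u(2)[OF this] have "(y \<bullet> f y) / (norm y)\<^sup>2 \<le> l"
        by (simp add: l_def scale power2_eq_square field_simps)
      then show ?thesis using False by (simp add: field_simps dot_square_norm)
    qed (simp add: f)
    define z where "z = f u - l *\<^sub>R u"
    have zV: "z \<in> V" unfolding z_def
      using less.prems uV by (auto intro!: subspace_diff subspace_scale)
    have zu: "z \<bullet> u = 0" using f(2)[of u u] by (simp add: z_def inner_diff_left uu l_def)
    have "f u = z + l *\<^sub>R u" by (simp add: z_def)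
    then have fuz: "z \<bullet> f u = z \<bullet> z" using zu by (simp add: inner_add_right)
    have ufz: "u \<bullet> f z = z \<bullet> z" using f(2)[of u z] fuz inner_commute[of z "f u"] by simp
    \<comment> \<open>Perturbing the maximiser \<open>u\<close> along the residual \<open>z\<close>
      gains a term linear in \<open>t\<close>, which maximality bounds by a quadratic one; a small
      \<open>t\<close> then forces \<open>z = 0\<close>.\<close>
    have lin_quad: "2 * t * (z \<bullet> z) \<le> t\<^sup>2 * (l * (z \<bullet> z) - z \<bullet> f z)" for t
    proof -
      have "(u + t *\<^sub>R z) \<bullet> f (u + t *\<^sub>R z) = l + 2 * t * (z \<bullet> z) + t\<^sup>2 * (z \<bullet> f z)"
        by (simp add: add scale inner_add_left inner_add_right fuz ufz power2_eq_square l_def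
            algebra_simps)
      moreover have "(u + t *\<^sub>R z) \<bullet> (u + t *\<^sub>R z) = 1 + t\<^sup>2 * (z \<bullet> z)"
        unfolding inner_add_left inner_add_right
        by (simp add: zu inner_commute[of u z] power2_eq_square uu)
      moreover have "u + t *\<^sub>R z \<in> V"
        using zV uV less.prems by (auto intro!: subspace_add subspace_scale)
      ultimately show ?thesis using le[of "u + t *\<^sub>R z"] by (simp add: algebra_simps)
    qed
    have "z \<bullet> z = 0"
    proof (rule ccontr)
      assume "z \<bullet> z \<noteq> 0"
      then have zz: "z \<bullet> z > 0" by simp
      define k where "k = \<bar>l * (z \<bullet> z) - z \<bullet> f z\<bar> + 1"
      have k: "k > 0" "l * (z \<bullet> z) - z \<bullet> f z \<le> k" by (auto simp: k_def)
      \<comment> \<open>This \<open>t\<close> makes the quadratic bound \<open>t\<^sup>2 * k\<close>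
        equal to half of the linear term.\<close>
      define t where "t = (z \<bullet> z) / k"
      have t: "t > 0" using zz k by (simp add: t_def)
      have "2 * t * (z \<bullet> z) \<le> t\<^sup>2 * k"
        using lin_quad[of t] mult_left_mono[OF k(2), of "t\<^sup>2"] by simp
      also have "\<dots> = t * (z \<bullet> z)" using k by (simp add: t_def power2_eq_square)
      finally show False using t zz by simp
    qed
    then have fu: "f u = l *\<^sub>R u" by (simp add: z_def)
    define W where "W = V \<inter> {y. orthogonal u y}"
    have W: "subspace W" unfolding W_def
      by (intro subspace_inter less.prems subspace_orthogonal_to_vector)
    moreover have fW: "f ` W \<subseteq> W"
      using less.prems f(2)[of u] by (auto simp: W_def orthogonal_def fu)
    moreover have "dim W < dim V"
    proof (rule dim_psubset)
      have "u \<notin> W" using uu by (simp add: W_def orthogonal_def)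
      then have "W \<subset> V" using uV by (auto simp: W_def)
      then show "span W \<subset> span V" using W less.prems by (simp add: span_eq_iff[THEN iffD2])
    qed
    ultimately obtain B where B: "pairwise orthogonal B"
      "\<And>b. b \<in> B \<Longrightarrow> norm b = 1 \<and> (\<exists>l. f b = l *\<^sub>R b)" "span B = W"
      using less.hyps by blast
    have BW: "B \<subseteq> W" using B(3) span_superset by blast
    have "span (insert u B) = V"
    proof
      show "span (insert u B) \<subseteq> V"
        using BW uV less.prems by (intro span_minimal) (auto simp: W_def)
      show "V \<subseteq> span (insert u B)"
      proof
        fix x assume x: "x \<in> V"
        have "x - (x \<bullet> u) *\<^sub>R u \<in> W" unfolding W_def
          using x uV less.prems uu
          by (auto intro!: subspace_diff subspace_scale simp: orthogonal_def inner_diff_right inner_commute)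
        then show "x \<in> span (insert u B)" using B(3) by (auto simp: span_insert)
      qed
    qed
    moreover have "pairwise orthogonal (insert u B)"
      using B(1) BW by (auto simp: pairwise_insert W_def orthogonal_commute)
    ultimately show ?thesis using B(2) uV fu by (intro exI[of _ "insert u B"]) auto
  qed
qed

section \<open>Orthogonal diagonalisation and square roots\<close>

definition diag_matrix :: "('n \<Rightarrow> real) \<Rightarrow> real ^ 'n ^ 'n" where
  "diag_matrix d = (\<chi> i j. if i = j then d i else 0)"

lemma diag_matrix_axis [simp]: "diag_matrix d *v axis k 1 = d k *\<^sub>R axis k 1"
  unfolding matrix_vector_mult_basis by (auto simp: diag_matrix_def column_def vec_eq_iff axis_def)

lemma diag_matrix_mult: "diag_matrix d ** diag_matrix e = diag_matrix (\<lambda>i. d i * e i)"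
  by (simp add: diag_matrix_def matrix_matrix_mult_def vec_eq_iff if_distrib[of "\<lambda>x. x * _"] cong: if_cong)

lemma transpose_diag_matrix [simp]: "transpose (diag_matrix d) = diag_matrix d"
  by (auto simp: diag_matrix_def transpose_def vec_eq_iff)

lemma det_diag_matrix: "det (diag_matrix d) = prod d UNIV"
  by (subst det_diagonal) (auto simp: diag_matrix_def)

lemma trace_diag_matrix: "trace (diag_matrix d) = sum d UNIV"
  by (simp add: diag_matrix_def trace_def)

text \<open>An orthonormal eigenbasis has as many elements as there are indices; any enumeration of
  it supplies the columns of \<open>U\<close>.\<close>

theorem symmetric_matrix_diagonalizable:
  fixes A :: "real ^ 'n ^ 'n"
  assumes "transpose A = A"
  obtains U d where "orthogonal_matrix U" "A = U ** diag_matrix d ** transpose U"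
proof -
  obtain B where B: "pairwise orthogonal B" "\<And>b. b \<in> B \<Longrightarrow> norm b = 1"
    "\<And>b. b \<in> B \<Longrightarrow> \<exists>l. A *v b = l *\<^sub>R b" "span B = UNIV"
    using selfadjoint_eigenbasis[of "(*v) A" UNIV] symmetric_inner[OF assms] by auto
  have "0 \<notin> B" using B(2) by force
  then have ind: "independent B" using B(1) pairwise_orthogonal_independent by blast
  have "card B = CARD('n)"
    using indep_card_eq_dim_span[OF ind] B(4) by simp
  then obtain f where f: "bij_betw f (UNIV::'n set) B"
    using ind by (metis finite_class.finite_UNIV finite_same_card_bij finiteI_independent)
  have fB: "f i \<in> B" for i using f by (auto simp: bij_betw_def)
  then have "\<forall>i. \<exists>l. A *v f i = l *\<^sub>R f i" using B(3) by blast
  then obtain d where d: "\<And>i. A *v f i = d i *\<^sub>R f i" by metis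
  define U :: "real ^ 'n ^ 'n" where "U = (\<chi> i j. f j $ i)"
  have orth: "orthogonal (f i) (f j)" if "i \<noteq> j" for i j
    using B(1) that fB f unfolding pairwise_def bij_betw_def inj_on_def by blast
  have U: "orthogonal_matrix U"
    using orth B(2)[OF fB] by (simp add: U_def orthogonal_matrix_orthonormal_columns column_def)
  have Uk: "U *v axis k 1 = f k" for k
    by (simp add: U_def matrix_vector_mult_basis column_def)
  have "A ** U = U ** diag_matrix d"
  proof -
    have "column k (A ** U) = column k (U ** diag_matrix d)" for k
      by (simp add: Uk d matrix_vector_mult_scaleR
          flip: matrix_vector_mult_basis matrix_vector_mul_assoc)
    then show ?thesis by (simp add: column_def vec_eq_iff)
  qed
  then have "A ** (U ** transpose U) = U ** diag_matrix d ** transpose U"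
    by (simp add: matrix_mul_assoc)
  then have "A = U ** diag_matrix d ** transpose U" using U by (simp add: orthogonal_matrix_def)
  with U that show ?thesis by blast
qed

text \<open>The entry \<open>d i\<close> is the value of the quadratic form of \<open>A\<close> at
  column \<open>i\<close> of \<open>U\<close>, a nonzero vector.\<close>

lemma posdef_diagonalizable:
  fixes A :: "real ^ 'n ^ 'n"
  assumes "posdef A"
  obtains U d where "orthogonal_matrix U" "A = U ** diag_matrix d ** transpose U" "\<And>i. d i > 0"
proof -
  obtain U d where U: "orthogonal_matrix U" and A: "A = U ** diag_matrix d ** transpose U"
    using assms symmetric_matrix_diagonalizable unfolding posdef_def by blast
  have UU: "transpose U ** U = mat 1" using U by (simp add: orthogonal_matrix_def)
  have "d i > 0" for i
  proof -
    let ?x = "U *v axis i 1"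
    have Tx: "transpose U *v ?x = axis i 1" by (simp add: matrix_vector_mul_assoc UU)
    have "?x \<noteq> 0" using Tx by (metis axis_eq_0_iff matrix_vector_mult_0_right zero_neq_one)
    then have "0 < ?x \<bullet> (A *v ?x)" using assms by (simp add: posdef_def)
    also have "A *v ?x = U *v (d i *\<^sub>R axis i 1)"
      unfolding A by (simp add: Tx flip: matrix_vector_mul_assoc)
    also have "?x \<bullet> \<dots> = d i"
      using Tx by (simp add: matrix_vector_mult_scaleR inner_axis_axis flip: inner_transpose)
    finally show ?thesis .
  qed
  with U A that show ?thesis by blast
qed

lemma det_orthogonal_conj:
  assumes "orthogonal_matrix U"
  shows "det (U ** A ** transpose U) = det (A :: real ^ 'n ^ 'n)"
proof -
  have "det U * det (transpose U) = 1"
    using assms by (metis det_I det_mul orthogonal_matrix_def)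
  then show ?thesis by (simp add: det_mul algebra_simps)
qed

lemma trace_orthogonal_conj:
  assumes "orthogonal_matrix U"
  shows "trace (U ** A ** transpose U) = trace (A :: real ^ 'n ^ 'n)"
  using assms by (subst trace_mul_sym) (simp add: matrix_mul_assoc orthogonal_matrix_def)

lemma posdef_det_pos: "posdef A \<Longrightarrow> det A > 0"
  by (elim posdef_diagonalizable) (simp add: det_orthogonal_conj det_diag_matrix prod_pos)

lemma posdef_congruence:
  assumes "posdef A" "invertible T"
  shows "posdef (transpose T ** A ** T)"
proof -
  have "T *v x \<noteq> 0" if "x \<noteq> 0" for x
    using assms(2) that by (metis invertible_def matrix_left_invertible_ker)
  then show ?thesis
    using assms(1) by (simp add: posdef_def matrix_transpose_mul matrix_mul_assoc inner_transpose
        flip: matrix_vector_mul_assoc)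
qed

lemma posdef_invertible: "posdef A \<Longrightarrow> invertible A"
  using posdef_det_pos by (force simp: invertible_det_nz)

text \<open>Take square roots of the eigenvalues. Such a root turns a quadratic form into a squared
  norm, which makes the triangle and Cauchy-Schwarz inequalities available.\<close>

lemma posdef_sqrt:
  fixes A :: "real ^ 'n ^ 'n"
  assumes "posdef A"
  obtains S where "posdef S" "S ** S = A"
proof -
  obtain U d where U: "orthogonal_matrix U" and A: "A = U ** diag_matrix d ** transpose U"
    and d: "\<And>i. d i > 0"
    using posdef_diagonalizable[OF assms] by metis
  have UU: "transpose U ** U = mat 1" "U ** transpose U = mat 1" using U by (simp_all add: orthogonal_matrix_def)
  define D where "D = diag_matrix (\<lambda>i. sqrt (d i))"
  have DD: "D ** D = diag_matrix d" using d by (simp add: D_def diag_matrix_mult less_imp_le)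
  have "posdef D"
  proof -
    have "(D *v x) $ i = sqrt (d i) * x $ i" for x i
      by (simp add: D_def diag_matrix_def matrix_vector_mult_def if_distrib[of "\<lambda>x. x * _"] cong: if_cong)
    then have "x \<bullet> (D *v x) = (\<Sum>i\<in>UNIV. sqrt (d i) * (x $ i)\<^sup>2)" for x
      by (simp add: inner_vec_def power2_eq_square mult_ac)
    moreover have "(\<Sum>i\<in>UNIV. sqrt (d i) * (x $ i)\<^sup>2) > 0" if x: "x \<noteq> 0" for x
    proof -
      obtain k where "x $ k \<noteq> 0" using x by (metis vec_eq_iff zero_index)
      then show ?thesis using d
        by (intro sum_pos2[of _ k]) (auto simp: less_imp_le)
    qed
    ultimately show ?thesis by (simp add: posdef_def D_def)
  qed
  moreover have "invertible (transpose U)" using UU invertible_def by blast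
  ultimately have "posdef (U ** D ** transpose U)"
    using posdef_congruence[of D "transpose U"] by simp
  moreover have "(U ** D ** transpose U) ** (U ** D ** transpose U) = A"
  proof -
    have "(U ** D ** transpose U) ** (U ** D ** transpose U) = U ** D ** (transpose U ** U) ** D ** transpose U"
      by (simp only: matrix_mul_assoc)
    also have "\<dots> = U ** (D ** D) ** transpose U" by (simp add: UU matrix_mul_assoc)
    finally show ?thesis by (simp add: DD A)
  qed
  ultimately show ?thesis using that by blast
qed

section \<open>Determinant against trace of a positive definite matrix\<close>

lemma posdef_ln_det_le:
  fixes S :: "real ^ 'n ^ 'n"
  assumes "posdef S" "s > 0"
  shows "ln (det S) \<le> trace S / s - CARD('n) + CARD('n) * ln s"
proof -
  obtain U d where S: "orthogonal_matrix U" "S = U ** diag_matrix d ** transpose U"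
    and d: "\<And>i. d i > 0"
    using posdef_diagonalizable[OF assms(1)] by metis
  \<comment> \<open>The tangent of \<open>ln\<close> at \<open>s\<close> lies above its graph; the
    later uses take \<open>s\<close> to be 1 or a mean scaling factor.\<close>
  have "ln (d i) \<le> d i / s - 1 + ln s" for i
    using ln_le_minus_one[of "d i / s"] d[of i] assms(2) by (simp add: ln_div)
  then have "(\<Sum>i\<in>UNIV. ln (d i)) \<le> (\<Sum>i\<in>UNIV. d i / s - 1 + ln s)" by (intro sum_mono)
  also have "\<dots> = sum d UNIV / s - CARD('n) + CARD('n) * ln s"
    by (simp add: sum.distrib sum_subtractf sum_divide_distrib)
  finally show ?thesis
    using d by (simp add: S det_orthogonal_conj trace_orthogonal_conj det_diag_matrix
        trace_diag_matrix ln_prod[of UNIV d, OF finite d[THEN less_imp_neq, THEN not_sym]])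
qed

text \<open>Equality case of the preceding bound: the nonnegative numbers
  \<open>d i - 1 - ln (d i)\<close> have sum at most 0, and each vanishes only at
  \<open>d i = 1\<close>.\<close>

lemma posdef_eq_one_if_trace_le:
  fixes S :: "real ^ 'n ^ 'n"
  assumes "posdef S" "det S = 1" "trace S \<le> CARD('n)"
  shows "S = mat 1"
proof -
  obtain U d where S: "orthogonal_matrix U" "S = U ** diag_matrix d ** transpose U"
    and d: "\<And>i. d i > 0"
    using posdef_diagonalizable[OF assms(1)] by metis
  have det: "prod d UNIV = 1" and tr: "sum d UNIV \<le> CARD('n)"
    using assms by (simp_all add: S det_orthogonal_conj trace_orthogonal_conj det_diag_matrix
        trace_diag_matrix)
  have nn: "d i - 1 - ln (d i) \<ge> 0" for i
    using ln_le_minus_one[OF d, of i] by simp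
  have "(\<Sum>i\<in>UNIV. ln (d i)) = 0"
    using det ln_prod[of UNIV d, OF finite d[THEN less_imp_neq, THEN not_sym]] by simp
  then have "(\<Sum>i\<in>UNIV. d i - 1 - ln (d i)) \<le> 0"
    using tr by (simp add: sum_subtractf)
  then have "(\<Sum>i\<in>UNIV. d i - 1 - ln (d i)) = 0"
    using sum_nonneg[of UNIV "\<lambda>i. d i - 1 - ln (d i)"] nn by (meson antisym)
  then have "d i - 1 - ln (d i) = 0" for i
    using nn by (simp add: sum_nonneg_eq_0_iff)
  then have "d i = 1" for i
    using ln_eq_minus_one[OF d, of i] by simp
  then have "diag_matrix d = mat 1" by (simp add: diag_matrix_def mat_def vec_eq_iff)
  then show ?thesis using S by (simp add: orthogonal_matrix_def)
qed

text \<open>The inverse is symmetric, hence equal to the congruence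
  \<open>transpose Ai ** A ** Ai\<close> of \<open>A\<close>.\<close>

lemma posdef_inverse:
  assumes "posdef A"
  obtains Ai where "A ** Ai = mat 1" "Ai ** A = mat 1" "posdef Ai"
proof -
  obtain Ai where Ai: "A ** Ai = mat 1" "Ai ** A = mat 1"
    using posdef_invertible[OF assms] unfolding invertible_def by blast
  have "transpose A ** transpose Ai = mat 1"
    using Ai(2) by (metis matrix_transpose_mul transpose_mat)
  then have tA: "transpose Ai = Ai"
    using Ai assms unfolding posdef_def by (metis matrix_mul_assoc matrix_mul_lid matrix_mul_rid)
  then have "posdef (transpose Ai ** A ** Ai)"
    using Ai assms by (intro posdef_congruence) (auto simp: invertible_def)
  then have "posdef Ai" by (simp add: tA Ai)
  with Ai that show ?thesis by blast
qed

lemma posdef_scaleR: "posdef A \<Longrightarrow> r > 0 \<Longrightarrow> posdef (r *\<^sub>R A)"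
  by (simp add: posdef_def transpose_scaleR flip: scaleR_matrix_vector_assoc)

lemma inner_square_sqrt:
  assumes "posdef S"
  shows "x \<bullet> (S ** S *v x) = (norm (S *v x))\<^sup>2"
  using assms by (simp add: posdef_def symmetric_inner dot_square_norm flip: matrix_vector_mul_assoc)

text \<open>With \<open>B\<close> a square root of \<open>Q\<close>, the ellipsoid is the preimage
  of the unit ball under the affine map that sends \<open>y\<close> to
  \<open>B *v (y - c)\<close>.\<close>

lemma convex_ellipsoid:
  assumes "posdef Q"
  shows "convex (ellipsoid c Q)"
proof -
  obtain B where B: "posdef B" "B ** B = Q" using posdef_sqrt[OF assms] .
  have mem: "y \<in> ellipsoid c Q \<longleftrightarrow> norm (B *v (y - c)) \<le> 1" for y
    unfolding ellipsoid_def using inner_square_sqrt[OF B(1), of "y - c"] B(2)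
    by (simp add: power2_le_iff_abs_le[of 1, simplified])
  show ?thesis
  proof (rule convexI)
    fix x y and u v :: real
    assume *: "x \<in> ellipsoid c Q" "y \<in> ellipsoid c Q" "0 \<le> u" "0 \<le> v" "u + v = 1"
    have "u *\<^sub>R x + v *\<^sub>R y - c = u *\<^sub>R x + v *\<^sub>R y - (u + v) *\<^sub>R c" using * by simp
    also have "\<dots> = u *\<^sub>R (x - c) + v *\<^sub>R (y - c)" by (simp add: algebra_simps)
    finally have "B *v (u *\<^sub>R x + v *\<^sub>R y - c) = u *\<^sub>R (B *v (x - c)) + v *\<^sub>R (B *v (y - c))"
      by (simp add: matrix_vector_right_distrib matrix_vector_mult_scaleR)
    moreover have "norm (u *\<^sub>R (B *v (x - c)) + v *\<^sub>R (B *v (y - c))) \<le> u * 1 + v * 1"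
      using * mem by (intro norm_triangle_le add_mono) (simp_all add: mult_left_le)
    ultimately show "u *\<^sub>R x + v *\<^sub>R y \<in> ellipsoid c Q" using * by (simp add: mem)
  qed
qed

section \<open>Optimal designs\<close>

definition covariance :: "(real ^ 'n) set \<Rightarrow> (real ^ 'n \<Rightarrow> real) \<Rightarrow> real ^ 'n \<Rightarrow> real ^ 'n ^ 'n" where
  "covariance X w c = (\<Sum>p\<in>X. w p *\<^sub>R outer (p - c) (p - c))"

text \<open>The covariance equation says \<open>covariance X w c = Q\<^sup>-\<^sup>1 / n\<close>. This is the optimality certificate
  of John's theorem; that the points of positive weight lie on the boundary of the ellipsoid is
  implied and need not be required.\<close>

definition optimal_design ::
    "(real ^ 'n) set \<Rightarrow> (real ^ 'n \<Rightarrow> real) \<Rightarrow> real ^ 'n \<Rightarrow> real ^ 'n ^ 'n \<Rightarrow> bool" where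
  "optimal_design X w c Q \<longleftrightarrow> finite X \<and> (\<forall>p\<in>X. 0 \<le> w p) \<and> sum w X = 1 \<and>
     (\<Sum>p\<in>X. w p *\<^sub>R p) = c \<and> posdef Q \<and>
     real CARD('n) *\<^sub>R (Q ** covariance X w c) = mat 1 \<and> X \<subseteq> ellipsoid c Q"

lemma transpose_covariance: "transpose (covariance X w c) = covariance X w c"
  by (simp add: covariance_def transpose_sum transpose_scaleR transpose_outer)

lemma covariance_quadratic_form:
  "y \<bullet> (covariance X w c *v y) = (\<Sum>p\<in>X. w p * ((p - c) \<bullet> y)\<^sup>2)"
  by (simp add: covariance_def sum_mult_vec inner_sum_right power2_eq_square inner_commute
      mult.assoc flip: scaleR_matrix_vector_assoc)

text \<open>With \<open>e = p - c\<close>, divide the membership inequality by \<open>s p\<close> and average with the weights: the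
  terms linear in \<open>e\<close> cancel because \<open>c\<close> is the barycentre. What remains is bounded below by
  \<open>|e|\<^sub>R\<^sup>2 / s \<ge> 2 |e|\<^sub>R - s\<close> and \<open>|e|\<^sub>R = |S B e| \<ge> B e \<bullet> S B e\<close> (as \<open>|B e| \<le> 1\<close>), and the latter averages
  to \<open>trace S / n\<close>.\<close>

lemma optimal_design_congruence:
  fixes Q :: "real ^ 'n ^ 'n" and w s :: "real ^ 'n \<Rightarrow> real"
  assumes D: "optimal_design X w c Q" and R: "posdef R"
    and s: "\<And>p. p \<in> X \<Longrightarrow> s p > 0"
    and mem: "\<And>p. p \<in> X \<Longrightarrow>
      (p - c + s p *\<^sub>R d) \<bullet> (R *v (p - c + s p *\<^sub>R d)) \<le> (s p)\<^sup>2"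
  obtains B S where "posdef B" "posdef S" "B ** B = Q" "R = B ** S ** S ** B"
    "2 * trace S \<le> CARD('n) * (\<Sum>p\<in>X. w p * s p) * (2 - d \<bullet> (R *v d))"
proof -
  have w: "\<And>p. p \<in> X \<Longrightarrow> 0 \<le> w p" "sum w X = 1" and
    c: "(\<Sum>p\<in>X. w p *\<^sub>R p) = c" and Q: "posdef Q" and
    cov: "real CARD('n) *\<^sub>R (Q ** covariance X w c) = mat 1" and XE: "X \<subseteq> ellipsoid c Q"
    using D by (auto simp: optimal_design_def)
  obtain B where B: "posdef B" "B ** B = Q" using posdef_sqrt[OF Q] .
  obtain Bi where Bi: "B ** Bi = mat 1" "Bi ** B = mat 1" "posdef Bi"
    using posdef_inverse[OF B(1)] .
  have tB: "transpose B = B" "transpose Bi = Bi" using B Bi by (auto simp: posdef_def)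
  have "posdef (transpose Bi ** R ** Bi)"
    using R Bi by (intro posdef_congruence) (auto simp: invertible_def)
  \<comment> \<open>\<open>S\<close> measures \<open>R\<close> relative to \<open>Q\<close>: the
    \<open>R\<close>-norm of \<open>x\<close> is the norm of \<open>S *v (B *v x)\<close>.\<close>
  then obtain S where S: "posdef S" "S ** S = Bi ** R ** Bi"
    unfolding tB using posdef_sqrt by blast
  have "B ** S ** S ** B = (B ** Bi) ** R ** (Bi ** B)"
    by (metis S(2) matrix_mul_assoc)
  then have Req: "R = B ** S ** S ** B" by (simp add: Bi)
  have tS: "transpose S = S" using S by (simp add: posdef_def)
  have Rform: "x \<bullet> (R *v x) = (norm (S *v (B *v x)))\<^sup>2" for x
    unfolding Req using tB tS
    by (simp add: symmetric_inner dot_square_norm flip: matrix_vector_mul_assoc)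
  have Rsym: "x \<bullet> (R *v y) = y \<bullet> (R *v x)" for x y
    using R by (metis inner_commute posdef_def symmetric_inner)
  let ?n = "real CARD('n)"
  define \<sigma> where "\<sigma> = (\<Sum>p\<in>X. w p * s p)"
  have mid: "(\<Sum>p\<in>X. w p * ((p - c) \<bullet> y)) = 0" for y
  proof -
    have "(\<Sum>p\<in>X. w p * ((p - c) \<bullet> y)) = (\<Sum>p\<in>X. w p *\<^sub>R (p - c)) \<bullet> y"
      by (simp add: inner_sum_left)
    also have "(\<Sum>p\<in>X. w p *\<^sub>R (p - c)) = 0"
      using c w by (simp add: scaleR_diff_right sum_subtractf flip: scaleR_sum_left)
    finally show ?thesis by simp
  qed
  \<comment> \<open>The covariance equation says that the vectors \<open>B *v (p - c)\<close> have
    second moment matrix \<open>mat 1\<close> divided by n, so averaging the form of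
    \<open>S\<close> over them gives its trace over n.\<close>
  have tr: "(\<Sum>p\<in>X. w p * ((B *v (p - c)) \<bullet> (S *v (B *v (p - c))))) = trace S / ?n"
  proof -
    have "B ** (B ** (?n *\<^sub>R covariance X w c)) = mat 1"
      using cov B(2) by (simp add: matrix_mul_assoc mult_scaleR_matrix)
    then have "Bi = Bi ** B ** (B ** (?n *\<^sub>R covariance X w c))"
      by (metis matrix_mul_assoc matrix_mul_rid)
    then have "?n *\<^sub>R (B ** covariance X w c ** B) = mat 1"
      by (metis Bi(2) matrix_mul_lid mult_scaleR_matrix scaleR_mult_matrix)
    then have "trace S = trace (S ** (?n *\<^sub>R (B ** covariance X w c ** B)))" by simp
    also have "\<dots> = ?n * trace (S ** B ** covariance X w c ** B)"
      by (simp add: mult_scaleR_matrix trace_scaleR matrix_mul_assoc)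
    also have "S ** B ** covariance X w c ** B =
        (\<Sum>p\<in>X. w p *\<^sub>R outer (S *v (B *v (p - c))) (B *v (p - c)))"
    proof -
      have "S ** B ** covariance X w c ** B = transpose (B ** transpose (S ** B ** covariance X w c))"
        by (simp add: matrix_transpose_mul tB)
      also have "\<dots> = (\<Sum>p\<in>X. w p *\<^sub>R outer (S *v (B *v (p - c))) (B *v (p - c)))"
        by (simp add: covariance_def mult_sum_matrix mult_scaleR_matrix mult_outer transpose_sum
            transpose_scaleR transpose_outer matrix_vector_mul_assoc)
      finally show ?thesis .
    qed
    finally show ?thesis
      by (simp add: trace_sum trace_scaleR trace_outer inner_commute)
  qed
  have pt: "w p * (2 * ((B *v (p - c)) \<bullet> (S *v (B *v (p - c)))))
      + 2 * (w p * ((p - c) \<bullet> (R *v d))) + w p * s p * (d \<bullet> (R *v d)) \<le> 2 * (w p * s p)"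
    if p: "p \<in> X" for p
  proof -
    define e where "e = p - c"
    define x where "x = norm (S *v (B *v e))"
    have "(norm (B *v e))\<^sup>2 \<le> 1"
      using p XE inner_square_sqrt[OF B(1), of e] B(2) by (auto simp: ellipsoid_def e_def)
    then have "norm (B *v e) \<le> 1" by (simp add: power2_le_iff_abs_le[of 1, simplified])
    then have "(B *v e) \<bullet> (S *v (B *v e)) \<le> 1 * x" unfolding x_def
      by (meson norm_cauchy_schwarz mult_right_mono norm_ge_zero order_trans)
    then have "2 * ((B *v e) \<bullet> (S *v (B *v e))) * s p \<le> 2 * x * s p"
      using s[OF p] by simp
    also have "\<dots> \<le> x\<^sup>2 + (s p)\<^sup>2" using sum_squares_bound[of x "s p"] by simp
    also have "x\<^sup>2 = e \<bullet> (R *v e)" by (simp add: Rform x_def)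
    also have "\<dots> \<le> (s p)\<^sup>2 - 2 * s p * (e \<bullet> (R *v d)) - (s p)\<^sup>2 * (d \<bullet> (R *v d))"
      using mem[OF p] Rsym[of d e]
      by (simp add: e_def[symmetric] inner_add_left inner_add_right matrix_vector_right_distrib
          matrix_vector_mult_scaleR power2_eq_square algebra_simps)
    finally have "s p * (2 * ((B *v e) \<bullet> (S *v (B *v e))) + 2 * (e \<bullet> (R *v d)) + s p * (d \<bullet> (R *v d)))
        \<le> s p * (2 * s p)"
      by (simp add: algebra_simps power2_eq_square)
    then have "2 * ((B *v e) \<bullet> (S *v (B *v e))) + 2 * (e \<bullet> (R *v d)) + s p * (d \<bullet> (R *v d)) \<le> 2 * s p"
      using s[OF p] by simp
    from mult_left_mono[OF this w(1)[OF p]] show ?thesis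
      by (simp add: e_def algebra_simps)
  qed
  have "(\<Sum>p\<in>X. w p * (2 * ((B *v (p - c)) \<bullet> (S *v (B *v (p - c)))))
      + 2 * (w p * ((p - c) \<bullet> (R *v d))) + w p * s p * (d \<bullet> (R *v d))) \<le> (\<Sum>p\<in>X. 2 * (w p * s p))"
    by (intro sum_mono pt)
  also have "(\<Sum>p\<in>X. w p * (2 * ((B *v (p - c)) \<bullet> (S *v (B *v (p - c)))))
      + 2 * (w p * ((p - c) \<bullet> (R *v d))) + w p * s p * (d \<bullet> (R *v d)))
     = 2 * (\<Sum>p\<in>X. w p * ((B *v (p - c)) \<bullet> (S *v (B *v (p - c)))))
      + 2 * (\<Sum>p\<in>X. w p * ((p - c) \<bullet> (R *v d))) + \<sigma> * (d \<bullet> (R *v d))"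
    by (simp add: sum.distrib sum_distrib_left sum_distrib_right \<sigma>_def mult.left_commute)
  also have "\<dots> = 2 * (trace S / ?n) + \<sigma> * (d \<bullet> (R *v d))" by (simp only: mid tr)
  also have "(\<Sum>p\<in>X. 2 * (w p * s p)) = 2 * \<sigma>" by (simp add: \<sigma>_def sum_distrib_left)
  finally have "2 * trace S \<le> ?n * \<sigma> * (2 - d \<bullet> (R *v d))"
    by (simp add: field_simps)
  with B S Req show ?thesis using that unfolding \<sigma>_def by blast
qed

text \<open>Pulling \<open>Q'\<close> back along a linear map \<open>T\<close> reduces this to the
  congruence lemma with \<open>s p = 1 - p \<bullet> h\<close>, whose weighted mean is
  \<open>\<sigma>\<close>. The resulting \<open>trace S \<le> n * \<sigma>\<close> contributes the
  exponent 2n, and \<open>det T = 1 / \<sigma>\<close> contributes the remaining 2.\<close>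

theorem optimal_design_projective_bound:
  fixes Q :: "real ^ 'n ^ 'n"
  assumes D: "optimal_design X w c Q" and Q': "posdef Q'"
    and h: "\<And>p. p \<in> X \<Longrightarrow> p \<bullet> h < 1"
    and mem: "\<And>p. p \<in> X \<Longrightarrow> p /\<^sub>R (1 - p \<bullet> h) \<in> ellipsoid c' Q'"
  shows "c \<bullet> h < 1" "ln (det Q') \<le> ln (det Q) + 2 * (real CARD('n) + 1) * ln (1 - c \<bullet> h)"
proof -
  let ?n = "real CARD('n)"
  define \<sigma> where "\<sigma> = 1 - c \<bullet> h"
  have fin: "finite X" and w: "\<And>p. p \<in> X \<Longrightarrow> 0 \<le> w p" "sum w X = 1" and
    c: "(\<Sum>p\<in>X. w p *\<^sub>R p) = c" and Q: "posdef Q"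
    using D by (auto simp: optimal_design_def)
  have \<sigma>: "\<sigma> = (\<Sum>p\<in>X. w p * (1 - p \<bullet> h))"
    using w by (simp add: \<sigma>_def inner_sum_left sum_subtractf right_diff_distrib flip: c)
  have "\<sigma> > 0"
  proof -
    obtain p where p: "p \<in> X" "w p \<noteq> 0" using w(2) by (metis sum.neutral zero_neq_one)
    then have "w p > 0" using w(1)[OF p(1)] by simp
    then show ?thesis unfolding \<sigma> using p h w by (intro sum_pos2[OF fin p(1)]) (auto simp: less_imp_le)
  qed
  then show "c \<bullet> h < 1" by (simp add: \<sigma>_def)
  \<comment> \<open>\<open>T\<close> is chosen so that \<open>p / s - c / \<sigma> = T ((p - c) / s)\<close> for \<open>s = 1 - p \<bullet> h\<close>.\<close>
  define T where "T = mat 1 + outer c (h /\<^sub>R \<sigma>)"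
  have detT: "det T = 1 / \<sigma>"
    using \<open>\<sigma> > 0\<close> by (simp add: T_def det_one_plus_outer field_simps) (simp add: \<sigma>_def)
  have Tv: "T *v x = x + ((h \<bullet> x) / \<sigma>) *\<^sub>R c" for x
    by (simp add: T_def matrix_vector_mult_add_rdistrib divide_inverse mult.commute)
  have "invertible T" using detT \<open>\<sigma> > 0\<close> by (simp add: invertible_det_nz)
  then obtain Ti where Ti: "T ** Ti = mat 1" unfolding invertible_def by blast
  \<comment> \<open>\<open>d\<close> is the offset of the centres pulled back along
    \<open>T\<close>, so that \<open>T\<close> maps \<open>p - c + s *\<^sub>R d\<close> to
    \<open>s *\<^sub>R (p /\<^sub>R s - c')\<close>.\<close>
  define d where "d = Ti *v (c /\<^sub>R \<sigma> - c')"
  have Td: "T *v d = c /\<^sub>R \<sigma> - c'" by (simp add: d_def matrix_vector_mul_assoc Ti)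
  define R where "R = transpose T ** Q' ** T"
  have R: "posdef R" unfolding R_def by (intro posdef_congruence Q' \<open>invertible T\<close>)
  have Rform: "x \<bullet> (R *v x) = (T *v x) \<bullet> (Q' *v (T *v x))" for x
    by (simp add: R_def inner_transpose flip: matrix_vector_mul_assoc)
  have memR: "(p - c + (1 - p \<bullet> h) *\<^sub>R d) \<bullet> (R *v (p - c + (1 - p \<bullet> h) *\<^sub>R d)) \<le> (1 - p \<bullet> h)\<^sup>2"
    if p: "p \<in> X" for p
  proof -
    define s where "s = 1 - p \<bullet> h"
    have s: "s > 0" using h[OF p] by (simp add: s_def)
    have hp: "h \<bullet> (p - c) = \<sigma> - s" by (simp add: \<sigma>_def s_def inner_diff_right inner_commute)
    have "T *v (p - c + s *\<^sub>R d) = p - c + ((\<sigma> - s) / \<sigma>) *\<^sub>R c + s *\<^sub>R (c /\<^sub>R \<sigma> - c')"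
      by (simp only: matrix_vector_right_distrib matrix_vector_mult_scaleR Td) (simp only: Tv hp)
    also have "\<dots> = p - c + (((\<sigma> - s) / \<sigma> + s / \<sigma>)) *\<^sub>R c - s *\<^sub>R c'"
      by (simp add: scaleR_add_left scaleR_diff_right divide_inverse)
    also have "\<dots> = s *\<^sub>R (p /\<^sub>R s - c')"
      using \<open>\<sigma> > 0\<close> s by (simp add: scaleR_diff_right flip: add_divide_distrib)
    finally have "(p - c + s *\<^sub>R d) \<bullet> (R *v (p - c + s *\<^sub>R d))
        = s\<^sup>2 * ((p /\<^sub>R s - c') \<bullet> (Q' *v (p /\<^sub>R s - c')))"
      by (simp only: Rform matrix_vector_mult_scaleR) (simp add: power2_eq_square)
    also have "\<dots> \<le> s\<^sup>2 * 1"
      using mem[OF p] by (intro mult_left_mono) (simp_all add: ellipsoid_def s_def)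
    finally show ?thesis by (simp add: s_def)
  qed
  obtain B S where BS: "posdef B" "posdef S" "B ** B = Q" "R = B ** S ** S ** B"
    and tr: "2 * trace S \<le> ?n * (\<Sum>p\<in>X. w p * (1 - p \<bullet> h)) * (2 - d \<bullet> (R *v d))"
    using optimal_design_congruence[where s = "\<lambda>p. 1 - p \<bullet> h", OF D R _ memR] h by auto
  have "d \<bullet> (R *v d) \<ge> 0" using R by (cases "d = 0") (auto simp: posdef_def less_imp_le)
  then have "?n * \<sigma> * (2 - d \<bullet> (R *v d)) \<le> ?n * \<sigma> * 2"
    using \<open>\<sigma> > 0\<close> by (intro mult_left_mono) auto
  with tr[folded \<sigma>] have "2 * trace S \<le> ?n * \<sigma> * 2" by (rule order_trans)
  then have "trace S \<le> ?n * \<sigma>" by simp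
  then have "trace S / \<sigma> \<le> ?n" using \<open>\<sigma> > 0\<close> by (simp add: field_simps)
  then have S: "ln (det S) \<le> ?n * ln \<sigma>"
    using posdef_ln_det_le[OF BS(2) \<open>\<sigma> > 0\<close>] by simp
  have pos: "det B > 0" "det S > 0" "det Q' > 0" using BS Q' posdef_det_pos by auto
  have "det Q' / \<sigma>\<^sup>2 = det R"
    by (simp add: R_def det_mul detT power2_eq_square)
  also have "\<dots> = det Q * (det S)\<^sup>2"
    by (simp add: BS(4) det_mul power2_eq_square flip: BS(3))
  finally have "det Q' = det Q * (det S)\<^sup>2 * \<sigma>\<^sup>2" using \<open>\<sigma> > 0\<close> by (simp add: field_simps)
  then have "ln (det Q') = ln (det Q) + 2 * ln (det S) + 2 * ln \<sigma>"
    using posdef_det_pos[OF Q] pos \<open>\<sigma> > 0\<close> by (simp add: ln_mult ln_realpow)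
  then show "ln (det Q') \<le> ln (det Q) + 2 * (?n + 1) * ln (1 - c \<bullet> h)"
    using S by (simp add: algebra_simps \<sigma>_def)
qed

text \<open>The congruence lemma with \<open>s = 1\<close> gives
  \<open>trace S \<le> n - n * q / 2\<close>, where \<open>q\<close> measures the offset of the
  centres, while \<open>det S \<ge> 1\<close> gives \<open>trace S \<ge> n\<close>. Hence
  \<open>q = 0\<close> and \<open>S\<close> is the identity.\<close>

lemma optimal_design_unique:
  fixes Q :: "real ^ 'n ^ 'n"
  assumes D: "optimal_design X w c Q" and Q': "posdef Q'"
    and sub: "X \<subseteq> ellipsoid c' Q'" and det: "det Q \<le> det Q'"
  shows "c' = c" "Q' = Q"
proof -
  let ?n = "real CARD('n)"
  have Q: "posdef Q" and w: "sum w X = 1" using D by (auto simp: optimal_design_def)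
  obtain B S where BS: "posdef B" "posdef S" "B ** B = Q" "Q' = B ** S ** S ** B"
    and tr: "2 * trace S \<le> ?n * (\<Sum>p\<in>X. w p * 1) * (2 - (c - c') \<bullet> (Q' *v (c - c')))"
    by (rule optimal_design_congruence[where s = "\<lambda>p. 1" and d = "c - c'", OF D Q'])
       (use sub in \<open>auto simp: ellipsoid_def\<close>)
  define q where "q = (c - c') \<bullet> (Q' *v (c - c'))"
  have q: "q \<ge> 0" using Q' by (cases "c = c'") (auto simp: posdef_def q_def less_imp_le)
  have tr': "trace S \<le> ?n - ?n * q / 2" using tr[folded q_def] w by (simp add: algebra_simps)
  have ge0: "?n * q \<ge> 0" using q by simp
  have pos: "det B > 0" "det S > 0" "det Q > 0" using BS Q posdef_det_pos by auto
  have "det Q' = det Q * (det S)\<^sup>2"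
    by (simp add: BS(4) det_mul power2_eq_square flip: BS(3))
  then have "1 \<le> (det S)\<^sup>2" using det pos by simp
  then have "1 \<le> det S" using pos power2_le_imp_le[of 1 "det S"] by simp
  then have "0 \<le> ln (det S)" by simp
  also have le: "\<dots> \<le> trace S - ?n" using posdef_ln_det_le[OF BS(2), of 1] by simp
  finally have "?n * q = 0" using tr' ge0 by linarith
  then have "q = 0" by simp
  then show "c' = c" using Q' unfolding q_def posdef_def by (metis eq_iff_diff_eq_0 less_irrefl)
  have "ln (det S) \<le> 0" using le tr' \<open>q = 0\<close> by simp
  then have "det S = 1" using \<open>1 \<le> det S\<close> pos by simp
  moreover have "trace S \<le> CARD('n)" using tr' \<open>q = 0\<close> by simp
  ultimately have "S = mat 1" using posdef_eq_one_if_trace_le[OF BS(2)] by blast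
  then show "Q' = Q" using BS by simp
qed

text \<open>Replaces differentiation at \<open>t = 0\<close>: Bernoulli's inequality turns the
  hypothesis into \<open>k - n \<le> n * k * t\<close>, which fails for one explicit small
  \<open>t\<close> if \<open>k > n\<close>.\<close>

lemma le_if_power_perturbation_le:
  fixes k :: real
  assumes "\<And>t. 0 < t \<Longrightarrow> t < 1 \<Longrightarrow> (1 - t) ^ n * (1 + t * k) \<le> 1"
  shows "k \<le> n"
proof (rule ccontr)
  assume "\<not> k \<le> n"
  then have k: "k > n" "k > 0" by (auto intro: le_less_trans[of 0 "real n"])
  \<comment> \<open>\<open>M\<close> exceeds both \<open>n * k\<close> and \<open>k - n\<close>, so
    \<open>t\<close> is below 1 and \<open>n * k * t\<close> is at most half of
    \<open>k - n\<close>.\<close>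
  define M where "M = (real n + 1) * (k + 1)"
  define t where "t = (k - n) / (2 * M)"
  have "1 * (k + 1) \<le> M" unfolding M_def using k by (intro mult_right_mono) auto
  then have "k + 1 \<le> M" by simp
  moreover have "k - n \<le> k" by simp
  ultimately have kM: "k - n < 2 * M" and M: "M > 0" using k by auto
  then have t: "t > 0" "t < 1" using k kM by (auto simp: t_def)
  have "(1 - n * t) * (1 + t * k) \<le> (1 - t) ^ n * (1 + t * k)"
    using Bernoulli_inequality[of "- t" n] t k by (intro mult_right_mono) auto
  also have "\<dots> \<le> 1" using assms t by blast
  finally have "t * (k - n - n * k * t) \<le> 0" by (simp add: algebra_simps)
  then have "k - n \<le> n * k * t" using t by (simp add: mult_le_0_iff)
  also have "\<dots> \<le> M * t" unfolding M_def using t k by (intro mult_right_mono mult_mono) auto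
  also have "\<dots> = (k - n) / 2" using M by (simp add: t_def)
  finally show False using k by simp
qed

lemma continuous_on_det:
  fixes f :: "'a :: topological_space \<Rightarrow> real ^ 'n ^ 'n"
  assumes "continuous_on A f"
  shows "continuous_on A (\<lambda>x. det (f x))"
  unfolding det_def by (intro continuous_intros assms)

text \<open>The moments \<open>(\<Sum> w p, \<Sum> w p p\<^sup>T)\<close> range over a compact convex hull. At a maximiser of the
  determinant of the covariance \<open>C\<close>, moving mass \<open>t\<close> to \<open>q\<close> turns \<open>C\<close> into
  \<open>(1 - t) (C + t (q - c) (q - c)\<^sup>T)\<close>; differentiating at \<open>t = 0\<close> puts \<open>q\<close> into \<open>E(c, C\<^sup>-\<^sup>1 / n)\<close>.\<close>

lemma optimal_design_exists:
  fixes X :: "(real ^ 'n) set"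
  assumes fin: "finite X" and span: "\<And>y. (\<And>p. p \<in> X \<Longrightarrow> p \<bullet> y \<le> 0) \<Longrightarrow> y = 0"
  obtains w c Q where "optimal_design X w c Q"
proof -
  let ?n = "real CARD('n)"
  define \<Phi> where "\<Phi> p = (p, outer p p)" for p :: "real ^ 'n"
  define H where "H = convex hull (\<Phi> ` X)"
  define F :: "(real ^ 'n) \<times> (real ^ 'n ^ 'n) \<Rightarrow> real ^ 'n ^ 'n"
    where "F z = snd z - outer (fst z) (fst z)" for z
  have F_cov: "F (\<Sum>p\<in>X. w p *\<^sub>R \<Phi> p) = covariance X w (\<Sum>p\<in>X. w p *\<^sub>R p)"
    if "sum w X = 1" for w
  proof -
    define c where "c = (\<Sum>p\<in>X. w p *\<^sub>R p)"
    have c: "(\<Sum>p\<in>X. w p * p $ i) = c $ i" for i by (simp add: c_def)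
    have "(\<Sum>p\<in>X. w p * (p $ i * p $ j)) - c $ i * c $ j
        = (\<Sum>p\<in>X. w p * ((p $ i - c $ i) * (p $ j - c $ j)))" for i j
    proof -
      have "(\<Sum>p\<in>X. w p * ((p $ i - c $ i) * (p $ j - c $ j)))
        = (\<Sum>p\<in>X. w p * (p $ i * p $ j)) - c $ j * (\<Sum>p\<in>X. w p * p $ i)
          - c $ i * (\<Sum>p\<in>X. w p * p $ j) + c $ i * c $ j * sum w X"
        by (simp add: algebra_simps sum.distrib sum_subtractf sum_distrib_left)
      then show ?thesis by (simp add: c that)
    qed
    moreover have "fst (\<Sum>p\<in>X. w p *\<^sub>R \<Phi> p) = c" "snd (\<Sum>p\<in>X. w p *\<^sub>R \<Phi> p) = (\<Sum>p\<in>X. w p *\<^sub>R outer p p)"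
      by (simp_all add: \<Phi>_def fst_sum snd_sum c_def)
    ultimately show ?thesis
      by (simp add: F_def covariance_def vec_eq_iff outer_def flip: c_def)
  qed
  have HI: "(\<Sum>p\<in>X. w p *\<^sub>R \<Phi> p) \<in> H" if "\<And>p. p \<in> X \<Longrightarrow> 0 \<le> w p" "sum w X = 1" for w
    unfolding H_def using that fin
    by (intro convex_sum) (auto intro: hull_inc)
  have HE: "\<exists>w. (\<forall>p\<in>X. 0 \<le> w p) \<and> sum w X = 1 \<and> z = (\<Sum>p\<in>X. w p *\<^sub>R \<Phi> p)" if z: "z \<in> H" for z
  proof -
    have inj: "inj_on \<Phi> X" by (auto simp: inj_on_def \<Phi>_def)
    obtain u where "\<forall>x\<in>\<Phi> ` X. 0 \<le> u x" "sum u (\<Phi> ` X) = 1" "(\<Sum>x\<in>\<Phi> ` X. u x *\<^sub>R x) = z"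
      using z fin unfolding H_def by (auto simp: convex_hull_finite)
    then show ?thesis
      by (intro exI[of _ "u \<circ> \<Phi>"]) (auto simp: sum.reindex[OF inj])
  qed
  have "X \<noteq> {}" using span[of "axis undefined 1"] by (auto simp: axis_eq_0_iff)
  have compact: "compact H" unfolding H_def using fin by (simp add: finite_imp_compact_convex_hull)
  have "continuous_on H (\<lambda>z. det (F z))" unfolding F_def outer_def
    by (intro continuous_on_det continuous_intros continuous_on_vec_lambda)
  moreover have "H \<noteq> {}" using \<open>X \<noteq> {}\<close> by (simp add: H_def)
  ultimately obtain z where z: "z \<in> H" and max: "\<And>y. y \<in> H \<Longrightarrow> det (F y) \<le> det (F z)"
    using continuous_attains_sup[OF compact] by blast
  obtain w where w: "\<And>p. p \<in> X \<Longrightarrow> 0 \<le> w p" "sum w X = 1" "z = (\<Sum>p\<in>X. w p *\<^sub>R \<Phi> p)"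
    using HE[OF z] by blast
  define c where "c = (\<Sum>p\<in>X. w p *\<^sub>R p)"
  define C where "C = covariance X w c"
  have Fz: "F z = C" using w F_cov by (simp add: C_def c_def)
  have detC: "det C > 0"
  proof -
    \<comment> \<open>Uniform weights show that the maximum is positive: a null direction
      \<open>y\<close> of their covariance gives all points the same inner product with
      \<open>y\<close>, and \<open>span\<close>, applied to \<open>y\<close> or \<open>- y\<close>
      according to its sign, yields \<open>y = 0\<close>.\<close>
    define u where "u = (\<lambda>p :: real ^ 'n. 1 / real (card X))"
    have card: "card X > 0" using fin \<open>X \<noteq> {}\<close> by (simp add: card_gt_0_iff)
    have u: "\<And>p. u p > 0" "sum u X = 1" using card by (auto simp: u_def)
    define m where "m = (\<Sum>p\<in>X. u p *\<^sub>R p)"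
    have "posdef (covariance X u m)"
    proof -
      have "y = 0" if "y \<bullet> (covariance X u m *v y) \<le> 0" for y
      proof -
        have nn: "u p * ((p - m) \<bullet> y)\<^sup>2 \<ge> 0" for p using u(1)[of p] by simp
        have "(\<Sum>p\<in>X. u p * ((p - m) \<bullet> y)\<^sup>2) = 0"
          using that sum_nonneg[of X "\<lambda>p. u p * ((p - m) \<bullet> y)\<^sup>2"] nn
          by (simp add: covariance_quadratic_form)
        then have "\<And>p. p \<in> X \<Longrightarrow> u p * ((p - m) \<bullet> y)\<^sup>2 = 0"
          using fin nn by (simp add: sum_nonneg_eq_0_iff)
        then have *: "p \<bullet> y = m \<bullet> y" if "p \<in> X" for p
          using u(1)[of p] that by (fastforce simp: inner_diff_left)
        show "y = 0"
        proof (cases "m \<bullet> y \<le> 0")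
          case True
          then show ?thesis using span[of y] * by simp
        next
          case False
          then show ?thesis using span[of "- y"] * by simp
        qed
      qed
      then show ?thesis unfolding posdef_def transpose_covariance by force
    qed
    then have "0 < det (covariance X u m)" by (rule posdef_det_pos)
    also have "\<dots> = det (F (\<Sum>p\<in>X. u p *\<^sub>R \<Phi> p))" using F_cov[OF u(2)] by (simp add: m_def)
    also have "\<dots> \<le> det C" using u max HI[of u] by (simp add: Fz less_imp_le)
    finally show ?thesis .
  qed
  have C: "posdef C"
  proof -
    \<comment> \<open>The form of \<open>C\<close> is a weighted sum of squares, so a direction
      where it vanishes lies in the kernel, which is trivial because
      \<open>det C > 0\<close>.\<close>
    have "y = 0" if "y \<bullet> (C *v y) \<le> 0" for y
    proof -
      have nn: "w p * ((p - c) \<bullet> y)\<^sup>2 \<ge> 0" if "p \<in> X" for p using w(1)[OF that] by simp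
      have "(\<Sum>p\<in>X. w p * ((p - c) \<bullet> y)\<^sup>2) = 0"
        using that sum_nonneg[of X "\<lambda>p. w p * ((p - c) \<bullet> y)\<^sup>2"] nn
        by (simp add: C_def covariance_quadratic_form)
      then have "\<And>p. p \<in> X \<Longrightarrow> w p * ((p - c) \<bullet> y)\<^sup>2 = 0"
        using fin nn by (simp add: sum_nonneg_eq_0_iff)
      then have "\<And>p. p \<in> X \<Longrightarrow> w p * ((p - c) \<bullet> y) = 0" by auto
      then have "C *v y = 0"
        by (auto simp: C_def covariance_def sum_mult_vec simp flip: scaleR_matrix_vector_assoc
            intro!: sum.neutral)
      then show ?thesis using detC
        by (metis invertible_def invertible_det_nz less_irrefl matrix_left_invertible_ker)
    qed
    then show ?thesis unfolding posdef_def by (force simp: C_def transpose_covariance)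
  qed
  obtain Ci where Ci: "C ** Ci = mat 1" "Ci ** C = mat 1" "posdef Ci"
    using posdef_inverse[OF C] .
  have opt: "(q - c) \<bullet> (Ci *v (q - c)) \<le> ?n" if q: "q \<in> X" for q
  proof (rule le_if_power_perturbation_le)
    fix t :: real assume t: "0 < t" "t < 1"
    define d where "d = q - c"
    have "(1 - t) *\<^sub>R z + t *\<^sub>R \<Phi> q \<in> H"
      using z q t unfolding H_def
      by (intro convexD[OF convex_convex_hull]) (auto intro: hull_inc)
    then have "det (F ((1 - t) *\<^sub>R z + t *\<^sub>R \<Phi> q)) \<le> det C" using max by (simp add: Fz)
    \<comment> \<open>Factoring out \<open>C\<close> leaves a rank-one update of the identity, and
      \<open>det C\<close> cancels from the comparison.\<close>
    moreover have "F ((1 - t) *\<^sub>R z + t *\<^sub>R \<Phi> q) = (1 - t) *\<^sub>R (C ** (mat 1 + outer (t *\<^sub>R (Ci *v d)) d))"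
    proof -
      have zc: "fst z = c" by (simp add: w(3) fst_sum \<Phi>_def c_def)
      have "F ((1 - t) *\<^sub>R z + t *\<^sub>R \<Phi> q) = (1 - t) *\<^sub>R (F z + t *\<^sub>R outer d d)"
        by (simp add: F_def zc \<Phi>_def d_def outer_def vec_eq_iff algebra_simps)
      also have "F z + t *\<^sub>R outer d d = C ** (mat 1 + outer (t *\<^sub>R (Ci *v d)) d)"
        by (simp add: Fz matrix_add_ldistrib mult_outer matrix_vector_mult_scaleR
            matrix_vector_mul_assoc Ci outer_scaleR_left mult_scaleR_matrix)
      finally show ?thesis .
    qed
    ultimately have "((1 - t) ^ CARD('n) * (1 + t * (d \<bullet> (Ci *v d)))) * det C \<le> 1 * det C"
      by (simp add: det_scaleR det_mul det_one_plus_outer inner_commute mult_ac)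
    then show "(1 - t) ^ CARD('n) * (1 + t * ((q - c) \<bullet> (Ci *v (q - c)))) \<le> 1"
      unfolding d_def using detC mult_le_cancel_right_pos by blast
  qed
  \<comment> \<open>The factor 1/n turns the bound n in \<open>opt\<close> into the 1 of the
    ellipsoid.\<close>
  have "optimal_design X w c (Ci /\<^sub>R ?n)"
    unfolding optimal_design_def
  proof (intro conjI)
    show "posdef (Ci /\<^sub>R ?n)" using Ci by (intro posdef_scaleR) simp_all
    show "?n *\<^sub>R (Ci /\<^sub>R ?n ** covariance X w c) = mat 1"
      using Ci by (simp add: scaleR_mult_matrix C_def)
    show "X \<subseteq> ellipsoid c (Ci /\<^sub>R ?n)"
      using opt by (auto simp: ellipsoid_def field_simps simp flip: scaleR_matrix_vector_assoc)
  qed (use fin w c_def in auto)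
  then show ?thesis using that by blast
qed

section \<open>Minimum ellipsoids and projective maps\<close>

lemma Vol_ellipsoid_le_iff:
  assumes "posdef Q" "posdef Q'"
  shows "Vol (ellipsoid c Q) \<le> Vol (ellipsoid c' Q') \<longleftrightarrow> det Q' \<le> det Q"
proof -
  note pos = assms[THEN posdef_det_pos]
  have "Vol (ellipsoid c Q) \<le> Vol (ellipsoid c' Q') \<longleftrightarrow>
      ln (Vol (ellipsoid c Q)) \<le> ln (Vol (ellipsoid c' Q'))"
    using pos assms by (intro ln_le_cancel_iff[symmetric]) (auto simp: Vol_ellipsoid)
  also have "\<dots> \<longleftrightarrow> det Q' \<le> det Q"
    using pos assms by (simp add: Vol_ellipsoid ln_powr del: ln_le_cancel_iff) simp
  finally show ?thesis .
qed

text \<open>Ellipsoids are convex, so they contain \<open>K\<close> exactly when they contain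
  \<open>X\<close>. Minimality is the projective bound at \<open>h = 0\<close>.\<close>

lemma MinCE_optimal_design:
  fixes X :: "(real ^ 'n) set"
  assumes D: "optimal_design X w c Q" and K: "X \<subseteq> K" "K \<subseteq> convex hull X"
  shows "MinCE K = ellipsoid c Q"
proof -
  have Q: "posdef Q" and X: "X \<subseteq> ellipsoid c Q" using D by (auto simp: optimal_design_def)
  have KE: "K \<subseteq> ellipsoid c Q"
    using K hull_minimal[of X "ellipsoid c Q" convex] X convex_ellipsoid[OF Q] by blast
  have det_le: "det Q' \<le> det Q" if "posdef Q'" "X \<subseteq> ellipsoid c' Q'" for c' Q'
  proof -
    have "ln (det Q') \<le> ln (det Q) + 2 * (real CARD('n) + 1) * ln (1 - c \<bullet> 0)"
      by (rule optimal_design_projective_bound(2)[OF D that(1)]) (use that in auto)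
    then show ?thesis using posdef_det_pos[OF Q] posdef_det_pos[OF that(1)] by simp
  qed
  show ?thesis unfolding MinCE_def
  proof (rule the_equality)
    show "is_MinCE K (ellipsoid c Q)"
      unfolding is_MinCE_def is_ellipsoid_def
      using Q KE K det_le Vol_ellipsoid_le_iff[OF Q] by (metis subset_trans)
  next
    fix E assume E: "is_MinCE K E"
    then obtain c' Q' where E': "posdef Q'" "E = ellipsoid c' Q'"
      by (auto simp: is_MinCE_def is_ellipsoid_def)
    have "Vol E \<le> Vol (ellipsoid c Q)"
      using E Q KE unfolding is_MinCE_def is_ellipsoid_def by blast
    then have "det Q \<le> det Q'" using Vol_ellipsoid_le_iff[OF E'(1) Q] E' by simp
    moreover have "X \<subseteq> ellipsoid c' Q'" using E E' K by (auto simp: is_MinCE_def)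
    ultimately show "E = ellipsoid c Q"
      using optimal_design_unique[OF D E'(1)] E' by blast
  qed
qed

text \<open>The projective image is itself an ellipsoid, but a cover that is exact to first order in \<open>h\<close>
  suffices and is easier to write down; the constant 5 leaves room for the second-order terms.\<close>

lemma projective_image_ellipsoid_cover:
  fixes Q Qi :: "real ^ 'n ^ 'n" and c h :: "real ^ 'n"
  defines "\<sigma> \<equiv> 1 - c \<bullet> h" and "\<beta> \<equiv> (1 - c \<bullet> h)\<^sup>2 - 5 * (h \<bullet> (Qi *v h))"
  assumes Q: "posdef Q" and Qi: "Q ** Qi = mat 1" and \<sigma>: "\<sigma> > 0" and \<beta>: "\<beta> > 0"
  obtains c' Q' where "posdef Q'"
    "ln (det Q') = CARD('n) * ln \<beta> + 2 * ln \<sigma> + ln (det Q)"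
    "\<And>p. p \<in> ellipsoid c Q \<Longrightarrow> p \<bullet> h < 1 \<Longrightarrow> (1 - p \<bullet> h)\<^sup>2 \<le> 4 * \<beta> \<Longrightarrow>
      p /\<^sub>R (1 - p \<bullet> h) \<in> ellipsoid c' Q'"
proof -
  define b where "b = \<beta>"
  define k where "k = Qi *v h"
  define \<eta> where "\<eta> = h \<bullet> k"
  have b: "b > 0" and b_eq: "b = (1 - c \<bullet> h)\<^sup>2 - 5 * \<eta>"
    using \<beta> by (auto simp: b_def \<beta>_def \<eta>_def k_def)
  have Qk: "Q *v k = h" by (simp add: k_def matrix_vector_mul_assoc Qi)
  \<comment> \<open>\<open>N\<close> straightens the projective map: for
    \<open>s = 1 - p \<bullet> h\<close> it sends \<open>p /\<^sub>R s\<close> to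
    \<open>(p - c) /\<^sub>R s + c\<close>.\<close>
  define N where "N = mat 1 + outer (- c) h"
  have detN: "det N = \<sigma>" by (simp add: N_def det_one_plus_outer \<sigma>_def)
  then have "invertible N" using \<sigma> by (simp add: invertible_det_nz)
  then obtain Ni where Ni: "N ** Ni = mat 1" unfolding invertible_def by blast
  have Nv: "N *v x = x - (h \<bullet> x) *\<^sub>R c" for x
    by (simp add: N_def matrix_vector_mult_add_rdistrib)
  \<comment> \<open>The shift by \<open>k /\<^sub>R b\<close> produces the cross term
    \<open>- 2 * s * u\<close> that the final estimate needs.\<close>
  define c' where "c' = Ni *v (c + k /\<^sub>R b)"
  define Q' where "Q' = b *\<^sub>R (transpose N ** Q ** N)"
  have "posdef Q'" unfolding Q'_def
    using b by (intro posdef_scaleR posdef_congruence Q \<open>invertible N\<close>)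
  moreover have "ln (det Q') = CARD('n) * ln b + 2 * ln \<sigma> + ln (det Q)"
    using posdef_det_pos[OF Q] b \<sigma>
    by (simp add: Q'_def det_scaleR det_mul detN ln_mult ln_realpow)
  moreover have "p /\<^sub>R (1 - p \<bullet> h) \<in> ellipsoid c' Q'"
    if p: "p \<in> ellipsoid c Q" "p \<bullet> h < 1" "(1 - p \<bullet> h)\<^sup>2 \<le> 4 * b" for p
  proof -
    define s where "s = 1 - p \<bullet> h"
    define e where "e = p - c"
    define u where "u = e \<bullet> h"
    have s: "s > 0" "s\<^sup>2 \<le> 4 * b" using p by (auto simp: s_def)
    have su: "s = (1 - c \<bullet> h) - u" by (simp add: s_def u_def e_def inner_diff_left)
    obtain B where B: "posdef B" "B ** B = Q" using posdef_sqrt[OF Q] .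
    have ell: "e \<bullet> (Q *v e) \<le> 1" using p by (simp add: ellipsoid_def e_def)
    have \<eta>B: "\<eta> = (norm (B *v k))\<^sup>2"
      using inner_square_sqrt[OF B(1), of k] B(2) by (simp add: \<eta>_def Qk inner_commute)
    \<comment> \<open>Cauchy-Schwarz in the \<open>Q\<close>-norm, using
      \<open>h = Q *v k\<close>.\<close>
    have "\<bar>u\<bar> \<le> norm (B *v e) * norm (B *v k)"
    proof -
      have "u = e \<bullet> (B *v (B *v k))" by (simp add: u_def matrix_vector_mul_assoc B Qk)
      also have "\<dots> = (B *v e) \<bullet> (B *v k)"
        using B(1) by (simp add: posdef_def symmetric_inner)
      finally show ?thesis using Cauchy_Schwarz_ineq2 by simp
    qed
    then have "u\<^sup>2 \<le> (norm (B *v e) * norm (B *v k))\<^sup>2"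
      by (metis abs_ge_zero power2_abs power_mono)
    also have "\<dots> = (e \<bullet> (Q *v e)) * \<eta>"
      using inner_square_sqrt[OF B(1), of e] B(2) by (simp add: \<eta>B power_mult_distrib)
    also have "\<dots> \<le> 1 * \<eta>" using ell by (intro mult_right_mono) (simp_all add: \<eta>B)
    finally have u: "u\<^sup>2 \<le> \<eta>" by simp
    then have "\<eta> \<ge> 0" by (meson order_trans zero_le_power2)
    have "h \<bullet> p = 1 - s" by (simp add: s_def inner_commute)
    then have "N *v (p /\<^sub>R s) = p /\<^sub>R s - ((1 - s) / s) *\<^sub>R c"
      by (simp add: Nv divide_inverse mult.commute)
    also have "\<dots> = e /\<^sub>R s + c" using s
      by (simp add: e_def diff_divide_distrib scaleR_diff_left scaleR_diff_right divide_inverse left_diff_distrib)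
    finally have "N *v (p /\<^sub>R s - c') = e /\<^sub>R s - k /\<^sub>R b"
      by (simp add: matrix_vector_mult_diff_distrib c'_def matrix_vector_mul_assoc Ni)
    moreover have "(p /\<^sub>R s - c') \<bullet> (Q' *v (p /\<^sub>R s - c'))
        = b * ((N *v (p /\<^sub>R s - c')) \<bullet> (Q *v (N *v (p /\<^sub>R s - c'))))"
      by (simp add: Q'_def inner_transpose flip: matrix_vector_mul_assoc scaleR_matrix_vector_assoc)
    ultimately have "(p /\<^sub>R s - c') \<bullet> (Q' *v (p /\<^sub>R s - c'))
        = b * ((e /\<^sub>R s - k /\<^sub>R b) \<bullet> (Q *v (e /\<^sub>R s - k /\<^sub>R b)))" by simp
    also have "\<dots> = b * ((e \<bullet> (Q *v e)) / s\<^sup>2 - 2 * u / (s * b) + \<eta> / b\<^sup>2)"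
    proof -
      have "k \<bullet> (Q *v e) = u"
        using Q by (simp add: posdef_def symmetric_inner Qk u_def inner_commute)
      moreover have "k \<bullet> h = \<eta>" by (simp add: \<eta>_def inner_commute)
      ultimately show ?thesis
        by (simp add: matrix_vector_mult_diff_distrib matrix_vector_mult_scaleR Qk inner_diff_left
            inner_diff_right divide_inverse power2_eq_square algebra_simps flip: u_def)
    qed
    also have "\<dots> = (b * (e \<bullet> (Q *v e)) - 2 * s * u + s\<^sup>2 * (\<eta> / b)) / s\<^sup>2"
      using s b by (simp add: field_simps power2_eq_square)
    also have "\<dots> \<le> 1"
    proof -
      have "b * (e \<bullet> (Q *v e)) \<le> b * 1" using ell b by (intro mult_left_mono) auto
      moreover have "s\<^sup>2 * (\<eta> / b) \<le> (4 * b) * (\<eta> / b)"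
        using s b \<open>\<eta> \<ge> 0\<close> by (intro mult_right_mono) auto
      moreover have "(4 * b) * (\<eta> / b) = 4 * \<eta>" using b by simp
      ultimately have "b * (e \<bullet> (Q *v e)) - 2 * s * u + s\<^sup>2 * (\<eta> / b) \<le> b - 2 * s * u + 4 * \<eta>"
        by linarith
      \<comment> \<open>Expanding \<open>(s + u)\<^sup>2\<close> in \<open>b\<close> cancels the
        cross term and leaves \<open>s\<^sup>2 + u\<^sup>2 - \<eta>\<close>: of the constant 5, four
        units absorb \<open>4 * \<eta>\<close> and one absorbs \<open>u\<^sup>2\<close>.\<close>
      also have "\<dots> \<le> s\<^sup>2"
        using u unfolding b_eq su by (simp add: power2_eq_square algebra_simps)
      finally show ?thesis using s by simp
    qed
    finally show ?thesis by (simp add: ellipsoid_def s_def)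
  qed
  ultimately show ?thesis using that unfolding b_def by blast
qed

section \<open>Differentiability and convexity from one-sided bounds\<close>

lemma has_derivative_sandwich:
  fixes f g :: "'a :: real_normed_vector \<Rightarrow> real"
  assumes lower: "\<forall>\<^sub>F y in at x. f' (y - x) \<le> f y - f x"
    and upper: "\<forall>\<^sub>F y in at x. f y - f x \<le> g y - g x"
    and g: "(g has_derivative f') (at x)"
  shows "(f has_derivative f') (at x)"
  unfolding has_derivative_iff_norm
proof
  show "bounded_linear f'" using g by (rule has_derivative_bounded_linear)
  have "((\<lambda>y. norm (g y - g x - f' (y - x)) / norm (y - x)) \<longlongrightarrow> 0) (at x)"
    using g unfolding has_derivative_iff_norm by blast
  then show "((\<lambda>y. norm (f y - f x - f' (y - x)) / norm (y - x)) \<longlongrightarrow> 0) (at x)"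
  \<comment> \<open>The two bounds place the remainder of \<open>f\<close> between 0 and the
    remainder of \<open>g\<close>.\<close>
  proof (rule Lim_null_comparison[rotated])
    show "\<forall>\<^sub>F y in at x. norm (norm (f y - f x - f' (y - x)) / norm (y - x))
        \<le> norm (g y - g x - f' (y - x)) / norm (y - x)"
      using lower upper by eventually_elim (auto intro!: divide_right_mono)
  qed
qed

text \<open>Average the subgradient inequalities based at the intermediate point \<open>z\<close>;
  their linear terms cancel.\<close>

lemma convex_on_if_subgradient:
  fixes f :: "'a :: real_inner \<Rightarrow> real"
  assumes S: "convex S" and sub: "\<And>x y. x \<in> S \<Longrightarrow> y \<in> S \<Longrightarrow> f x + g x \<bullet> (y - x) \<le> f y"
  shows "convex_on S f"
proof (rule convex_onI)
  fix t :: real and x y assume t: "0 < t" "t < 1" and xy: "x \<in> S" "y \<in> S"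
  define z where "z = (1 - t) *\<^sub>R x + t *\<^sub>R y"
  have z: "z \<in> S" unfolding z_def using S xy t by (intro convexD) auto
  have "(1 - t) * (f z + g z \<bullet> (x - z)) + t * (f z + g z \<bullet> (y - z)) \<le> (1 - t) * f x + t * f y"
    using sub[OF z] xy t by (intro add_mono mult_left_mono) auto
  moreover have "(1 - t) *\<^sub>R (x - z) + t *\<^sub>R (y - z) = 0" by (simp add: z_def algebra_simps)
  then have "(1 - t) * (g z \<bullet> (x - z)) + t * (g z \<bullet> (y - z)) = 0"
    by (metis inner_add_right inner_scaleR_right inner_zero_right)
  ultimately show "f ((1 - t) *\<^sub>R x + t *\<^sub>R y) \<le> (1 - t) * f x + t * f y"
    unfolding z_def[symmetric] by (simp add: algebra_simps)
qed (fact S)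

section \<open>The polar of a translated polytope\<close>

lemma inner_scaleR_inverse_diff:
  "(u /\<^sub>R r) \<bullet> (y - x) = (u \<bullet> y - u \<bullet> x) / (r :: real)"
  by (simp only: divide_inverse inner_diff_right inner_scaleR_left right_diff_distrib mult.commute)

text \<open>The constraint normals of \<open>P - x\<close>, rescaled so that every right-hand side
  is 1.\<close>

definition polar_points :: "(nat \<Rightarrow> real ^ 'n) \<Rightarrow> nat \<Rightarrow> real ^ 'n \<Rightarrow> (real ^ 'n) set" where
  "polar_points a m x = (\<lambda>i. a i /\<^sub>R (1 - a i \<bullet> x)) ` {1..m}"

context
  fixes a :: "nat \<Rightarrow> real ^ 'n" and m :: nat and P :: "(real ^ 'n) set"
  assumes P_def: "P = {x. \<forall>i\<in>{1..m}. a i \<bullet> x \<le> 1}" and bounded: "bounded P"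
begin

text \<open>A small step from \<open>x\<close> along \<open>a i\<close> stays in \<open>P\<close>
  and strictly increases the inner product with \<open>a i\<close>.\<close>

lemma interior_slack:
  assumes x: "x \<in> interior P" and i: "i \<in> {1..m}"
  shows "a i \<bullet> x < 1"
proof (cases "a i = 0")
  case False
  obtain r where r: "r > 0" "cball x r \<subseteq> P" using x by (meson mem_interior_cball)
  have "x + (r / norm (a i)) *\<^sub>R a i \<in> P"
    using r False by (intro subsetD[OF r(2)]) (simp add: dist_norm)
  then have "a i \<bullet> x + r / norm (a i) * (a i \<bullet> a i) \<le> 1" using i by (simp add: P_def inner_add_right)
  moreover have "r / norm (a i) * (a i \<bullet> a i) > 0" using r False by simp
  ultimately show ?thesis by linarith
qed simp

lemma polar_points_subset_polar:
  assumes x: "x \<in> interior P"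
  shows "polar_points a m x \<subseteq> polar ((\<lambda>p. p - x) ` P)"
proof
  fix y assume "y \<in> polar_points a m x"
  then obtain i where i: "i \<in> {1..m}" "y = a i /\<^sub>R (1 - a i \<bullet> x)"
    by (auto simp: polar_points_def)
  have "y \<bullet> (p - x) \<le> 1" if "p \<in> P" for p
  proof -
    have "y \<bullet> (p - x) = (a i \<bullet> p - a i \<bullet> x) / (1 - a i \<bullet> x)"
      unfolding i by (rule inner_scaleR_inverse_diff)
    then show ?thesis using interior_slack[OF x i(1)] that i(1) by (simp add: P_def)
  qed
  then show "y \<in> polar ((\<lambda>p. p - x) ` P)" by (auto simp: polar_def)
qed

text \<open>Otherwise the ray from \<open>x\<close> in direction \<open>y\<close> would stay in
  \<open>P\<close>, against boundedness.\<close>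

lemma polar_points_spanning:
  assumes x: "x \<in> interior P" and y: "\<And>p. p \<in> polar_points a m x \<Longrightarrow> p \<bullet> y \<le> 0"
  shows "y = 0"
proof (rule ccontr)
  assume "y \<noteq> 0"
  obtain M where M: "\<And>p. p \<in> P \<Longrightarrow> norm p \<le> M" using bounded by (auto simp: bounded_iff)
  have neg: "a i \<bullet> y \<le> 0" if i: "i \<in> {1..m}" for i
    using y[of "a i /\<^sub>R (1 - a i \<bullet> x)"] i interior_slack[OF x i]
    by (auto simp: polar_points_def field_simps mult_le_0_iff)
  have xP: "x \<in> P" using x interior_subset by blast
  define t where "t = (M + norm x + 1) / norm y"
  have "M \<ge> 0" using M[OF xP] norm_ge_zero order_trans by blast
  then have t: "t \<ge> 0" by (simp add: t_def)
  have "a i \<bullet> (x + t *\<^sub>R y) \<le> 1" if "i \<in> {1..m}" for i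
    using neg[OF that] xP that t mult_nonneg_nonpos[of t "a i \<bullet> y"] by (force simp: P_def inner_add_right)
  then have "norm (x + t *\<^sub>R y) \<le> M" by (intro M) (simp add: P_def)
  then have "norm (t *\<^sub>R y) \<le> M + norm x"
    using norm_triangle_ineq4[of "x + t *\<^sub>R y" x] by simp
  then show False using t \<open>y \<noteq> 0\<close> by (simp add: t_def)
qed

text \<open>Separate \<open>y\<close> from the hull by \<open>g\<close>. If
  \<open>\<beta> \<ge> 0\<close>, spanning forces \<open>g = 0\<close>; if
  \<open>\<beta> < 0\<close>, the point \<open>x - g /\<^sub>R (- \<beta>)\<close> of
  \<open>P\<close> violates membership of \<open>y\<close> in the polar.\<close>

lemma polar_subset_hull:
  assumes x: "x \<in> interior P"
  shows "polar ((\<lambda>p. p - x) ` P) \<subseteq> convex hull polar_points a m x"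
proof (rule subsetI, rule ccontr)
  fix y assume y: "y \<in> polar ((\<lambda>p. p - x) ` P)" and nin: "y \<notin> convex hull polar_points a m x"
  have "closed (convex hull polar_points a m x)"
    unfolding polar_points_def
    by (intro compact_imp_closed finite_imp_compact_convex_hull finite_imageI finite_atLeastAtMost)
  then obtain g \<beta> where g: "g \<bullet> y < \<beta>" "\<And>z. z \<in> convex hull polar_points a m x \<Longrightarrow> g \<bullet> z > \<beta>"
    using separating_hyperplane_closed_point[OF convex_convex_hull _ nin] by blast
  have gp: "p \<bullet> (- g) < - \<beta>" if "p \<in> polar_points a m x" for p
    using g(2)[OF hull_inc[OF that]] by (simp add: inner_commute)
  show False
  proof (cases "\<beta> \<ge> 0")
    case True
    have "- g = 0" by (rule polar_points_spanning[OF x]) (use gp True in force)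
    moreover have "polar_points a m x \<noteq> {}"
      using polar_points_spanning[OF x, of "axis undefined 1"] by (auto simp: axis_eq_0_iff)
    then obtain p where "p \<in> polar_points a m x" by blast
    ultimately show False using gp[of p] True by simp
  next
    case False
    have "a i \<bullet> (x - g /\<^sub>R (- \<beta>)) \<le> 1" if i: "i \<in> {1..m}" for i
    proof -
      have "(a i /\<^sub>R (1 - a i \<bullet> x)) \<bullet> (- g) < - \<beta>"
        using i by (intro gp) (simp add: polar_points_def)
      then have "a i \<bullet> (- g) < - \<beta> * (1 - a i \<bullet> x)"
        using interior_slack[OF x i] by (simp add: field_simps)
      then have "(a i \<bullet> (- g)) / (- \<beta>) < 1 - a i \<bullet> x"
        using False by (simp add: divide_less_eq mult.commute del: minus_divide_left minus_mult_left)
      then show ?thesis by (simp add: inner_add_right divide_inverse mult.commute)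
    qed
    then have "x - g /\<^sub>R (- \<beta>) \<in> P" by (simp add: P_def)
    then have "y \<bullet> (x - g /\<^sub>R (- \<beta>) - x) \<le> 1" using y by (auto simp: polar_def)
    then show False using g(1) False by (simp add: inner_commute field_simps)
  qed
qed

text \<open>\<open>1 - p \<bullet> (y - x)\<close> is the quotient of the slacks at \<open>y\<close>
  and at \<open>x\<close>, so dividing by it exchanges one normalisation for the other.\<close>

lemma polar_points_translate:
  assumes x: "x \<in> interior P" and y: "y \<in> interior P" and p: "p \<in> polar_points a m x"
  shows "p \<bullet> (y - x) < 1" "p /\<^sub>R (1 - p \<bullet> (y - x)) \<in> polar_points a m y"
proof -
  obtain i where i: "i \<in> {1..m}" "p = a i /\<^sub>R (1 - a i \<bullet> x)"
    using p by (auto simp: polar_points_def)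
  note s = interior_slack[OF x i(1)] interior_slack[OF y i(1)]
  have "p \<bullet> (y - x) = (a i \<bullet> y - a i \<bullet> x) / (1 - a i \<bullet> x)"
    unfolding i by (rule inner_scaleR_inverse_diff)
  then have *: "1 - p \<bullet> (y - x) = (1 - a i \<bullet> y) / (1 - a i \<bullet> x)"
    using s by (simp add: diff_divide_eq_iff)
  then have "1 - p \<bullet> (y - x) > 0" using s by simp
  then show "p \<bullet> (y - x) < 1" by simp
  have "p /\<^sub>R (1 - p \<bullet> (y - x)) = a i /\<^sub>R (1 - a i \<bullet> y)"
    unfolding * using s by (simp add: i inverse_eq_divide)
  then show "p /\<^sub>R (1 - p \<bullet> (y - x)) \<in> polar_points a m y"
    using i by (auto simp: polar_points_def)
qed

text \<open>Lets an ellipsoid that covers the images of the points at \<open>x\<close> cover all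
  points at \<open>y\<close>.\<close>

lemma polar_points_translate_surj:
  assumes x: "x \<in> interior P" and y: "y \<in> interior P" and q: "q \<in> polar_points a m y"
  shows "\<exists>p\<in>polar_points a m x. q = p /\<^sub>R (1 - p \<bullet> (y - x))"
proof -
  obtain i where i: "i \<in> {1..m}" "q = a i /\<^sub>R (1 - a i \<bullet> y)"
    using q by (auto simp: polar_points_def)
  define p where "p = a i /\<^sub>R (1 - a i \<bullet> x)"
  note s = interior_slack[OF x i(1)] interior_slack[OF y i(1)]
  have "p \<bullet> (y - x) = (a i \<bullet> y - a i \<bullet> x) / (1 - a i \<bullet> x)"
    unfolding p_def by (rule inner_scaleR_inverse_diff)
  then have *: "1 - p \<bullet> (y - x) = (1 - a i \<bullet> y) / (1 - a i \<bullet> x)"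
    using s by (simp add: diff_divide_eq_iff)
  have "q = p /\<^sub>R (1 - p \<bullet> (y - x))"
    unfolding * using s by (simp add: i p_def inverse_eq_divide)
  then show ?thesis using i by (auto simp: polar_points_def p_def)
qed

lemma optimal_design_polar_points:
  assumes "x \<in> interior P"
  obtains w c Q where "optimal_design (polar_points a m x) w c Q"
proof -
  have "finite (polar_points a m x)" by (simp add: polar_points_def)
  then show ?thesis using optimal_design_exists polar_points_spanning[OF assms] that by blast
qed

lemma MinCE_polar_eq:
  assumes "x \<in> interior P" "optimal_design (polar_points a m x) w c Q"
  shows "MinCE_polar P x = ellipsoid c Q"
  unfolding MinCE_polar_def
  by (intro MinCE_optimal_design[OF assms(2)] polar_points_subset_polar polar_subset_hull assms(1))

end

theorem proposition1:
  fixes a :: "nat \<Rightarrow> real ^ 'n" and m :: nat and P :: "(real ^ 'n) set"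
    and v :: "real ^ 'n \<Rightarrow> real" and c :: "real ^ 'n \<Rightarrow> real ^ 'n"
  assumes P_def: "P = {x. \<forall>i\<in>{1..m}. a i \<bullet> x \<le> 1}"
    and bounded: "bounded P"
    and full_dim: "aff_dim P = int CARD('n)"
    and v_def: "\<And>x. x \<in> interior P \<Longrightarrow> v x = ln (Vol (MinCE_polar P x))"
    and c_def: "\<And>x. x \<in> interior P \<Longrightarrow> c x = ellipsoid_center (MinCE_polar P x)"
  shows "convex_on (interior P) v \<and>
    (\<forall>x\<in>interior P. GDERIV v x :> (real CARD('n) + 1) *\<^sub>R c x)"
proof -
  let ?n = "real CARD('n)" and ?X = "polar_points a m"
  note translate = polar_points_translate[OF P_def bounded]
  have "\<forall>x\<in>interior P. \<exists>w Q. optimal_design (?X x) w (c x) Q \<and> v x = - ln (det Q) / 2"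
  proof
    fix x assume x: "x \<in> interior P"
    obtain w c' Q where D: "optimal_design (?X x) w c' Q"
      using optimal_design_polar_points[OF P_def bounded x] .
    then have "posdef Q" by (simp add: optimal_design_def)
    then have "c x = c'" "v x = - ln (det Q) / 2"
      using MinCE_polar_eq[OF P_def bounded x D] c_def[OF x] v_def[OF x] posdef_det_pos[of Q]
      by (simp_all add: ellipsoid_center_ellipsoid Vol_ellipsoid ln_powr)
    with D show "\<exists>w Q. optimal_design (?X x) w (c x) Q \<and> v x = - ln (det Q) / 2" by blast
  qed
  then obtain w Q where D: "\<And>x. x \<in> interior P \<Longrightarrow> optimal_design (?X x) (w x) (c x) (Q x)"
    and v: "\<And>x. x \<in> interior P \<Longrightarrow> v x = - ln (det (Q x)) / 2" by metis
  have Q: "posdef (Q x)" and XE: "?X x \<subseteq> ellipsoid (c x) (Q x)" if "x \<in> interior P" for x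
    using D[OF that] by (auto simp: optimal_design_def)
  \<comment> \<open>The projective bound with \<open>h = y - x\<close>, linearised by
    \<open>ln (1 - r) \<le> - r\<close>.\<close>
  have lower: "v x + ((?n + 1) *\<^sub>R c x) \<bullet> (y - x) \<le> v y"
    if x: "x \<in> interior P" and y: "y \<in> interior P" for x y
  proof -
    have mem: "p /\<^sub>R (1 - p \<bullet> (y - x)) \<in> ellipsoid (c y) (Q y)" if "p \<in> ?X x" for p
      using translate(2)[OF x y that] XE[OF y] by blast
    note bound = optimal_design_projective_bound[OF D[OF x] Q[OF y] translate(1)[OF x y] mem]
    have "ln (1 - c x \<bullet> (y - x)) \<le> - (c x \<bullet> (y - x))"
      using ln_le_minus_one[of "1 - c x \<bullet> (y - x)"] bound(1) by simp
    then have "(?n + 1) * ln (1 - c x \<bullet> (y - x)) \<le> (?n + 1) * - (c x \<bullet> (y - x))"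
      by (intro mult_left_mono) auto
    then show ?thesis using bound(2) by (simp add: v[OF x] v[OF y] algebra_simps)
  qed
  have "P = (\<Inter>i\<in>{1..m}. {x. a i \<bullet> x \<le> 1})" by (auto simp: P_def)
  then have "convex P" by (auto intro: convex_INT convex_halfspace_le)
  then have "convex_on (interior P) v"
    using lower by (intro convex_on_if_subgradient convex_interior)
  moreover have "GDERIV v x :> (?n + 1) *\<^sub>R c x" if x: "x \<in> interior P" for x
  proof -
    obtain Qi where Qi: "Q x ** Qi = mat 1" using posdef_inverse[OF Q[OF x]] by blast
    define \<sigma> where "\<sigma> y = 1 - c x \<bullet> (y - x)" for y
    define \<beta> where "\<beta> y = (1 - c x \<bullet> (y - x))\<^sup>2 - 5 * ((y - x) \<bullet> (Qi *v (y - x)))" for y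
    \<comment> \<open>By the cover lemma, \<open>g y\<close> is the logarithmic volume of the
      covering ellipsoid minus \<open>v x\<close>; it vanishes at \<open>x\<close> and has the
      claimed gradient there.\<close>
    define g where "g y = - (?n / 2) * ln (\<beta> y) - ln (\<sigma> y)" for y
    have \<sigma>': "(\<sigma> has_derivative (\<lambda>h. - (c x \<bullet> h))) (at x)"
      unfolding \<sigma>_def by (auto intro!: derivative_eq_intros)
    have \<beta>': "(\<beta> has_derivative (\<lambda>h. - 2 * (c x \<bullet> h))) (at x)"
      unfolding \<beta>_def
      by (auto intro!: derivative_eq_intros bounded_linear.has_derivative[OF matrix_vector_mul_bounded_linear])
    have at_x: "\<sigma> x = 1" "\<beta> x = 1" by (simp_all add: \<sigma>_def \<beta>_def)
    have g': "(g has_derivative (\<lambda>h. ((?n + 1) *\<^sub>R c x) \<bullet> h)) (at x)"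
      unfolding g_def
      by (auto intro!: derivative_eq_intros \<sigma>' \<beta>' simp: at_x algebra_simps)
    have cont: "isCont \<sigma> x" "isCont \<beta> x" using \<sigma>' \<beta>' has_derivative_continuous by blast+
    have ev: "\<forall>\<^sub>F y in at x. y \<in> interior P" "\<forall>\<^sub>F y in at x. \<sigma> y > 0" "\<forall>\<^sub>F y in at x. \<beta> y > 0"
      using x cont order_tendstoD(1)[of \<sigma> 1 "at x" 0] order_tendstoD(1)[of \<beta> 1 "at x" 0]
      by (auto simp: at_x isCont_def intro: eventually_at_in_open')
    have "\<forall>\<^sub>F y in at x. (1 - p \<bullet> (y - x))\<^sup>2 < 4 * \<beta> y" for p
    proof -
      \<comment> \<open>The size condition of the cover holds near \<open>x\<close>, because at
        \<open>y = x\<close> it reads 1 < 4; finiteness of the point set then gives one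
        neighbourhood for all \<open>p\<close>.\<close>
      have "((\<lambda>y. 4 * \<beta> y - (1 - p \<bullet> (y - x))\<^sup>2) \<longlongrightarrow> 4 * \<beta> x - (1 - p \<bullet> (x - x))\<^sup>2) (at x)"
        using cont by (intro tendsto_intros) (simp add: isCont_def)
      from order_tendstoD(1)[OF this, of 0] show ?thesis by (simp add: at_x)
    qed
    then have "\<forall>\<^sub>F y in at x. \<forall>p\<in>?X x. (1 - p \<bullet> (y - x))\<^sup>2 < 4 * \<beta> y"
      by (intro eventually_ball_finite) (auto simp: polar_points_def)
    with ev have "\<forall>\<^sub>F y in at x. v y - v x \<le> g y - g x"
    proof eventually_elim
      case (elim y)
      obtain c' Q' where Q': "posdef Q'" "ln (det Q') = ?n * ln (\<beta> y) + 2 * ln (\<sigma> y) + ln (det (Q x))"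
        and mem: "\<And>p. p \<in> ellipsoid (c x) (Q x) \<Longrightarrow> p \<bullet> (y - x) < 1 \<Longrightarrow>
          (1 - p \<bullet> (y - x))\<^sup>2 \<le> 4 * \<beta> y \<Longrightarrow> p /\<^sub>R (1 - p \<bullet> (y - x)) \<in> ellipsoid c' Q'"
        using projective_image_ellipsoid_cover[OF Q[OF x] Qi, of "c x" "y - x"] elim
        unfolding \<sigma>_def \<beta>_def by metis
      have "q \<in> ellipsoid c' Q'" if q: "q \<in> ?X y" for q
      proof -
        obtain p where p: "p \<in> ?X x" "q = p /\<^sub>R (1 - p \<bullet> (y - x))"
          using polar_points_translate_surj[OF P_def bounded x elim(1) q] by blast
        then show ?thesis
          using mem[of p] translate(1)[OF x elim(1) p(1)] elim(4) XE[OF x] by (auto simp: less_imp_le)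
      qed
      \<comment> \<open>The projective bound at \<open>h = 0\<close>, based at \<open>y\<close>: the
        cover cannot have smaller volume than the minimum ellipsoid.\<close>
      then have "ln (det Q') \<le> ln (det (Q y))"
        using optimal_design_projective_bound(2)[OF D[OF elim(1)] Q'(1), of 0 c'] by simp
      then show ?case
        by (simp add: v[OF x] v[OF elim(1)] Q' g_def at_x field_simps)
    qed
    moreover have "\<forall>\<^sub>F y in at x. ((?n + 1) *\<^sub>R c x) \<bullet> (y - x) \<le> v y - v x"
      using ev(1) by eventually_elim (use lower[OF x] in force)
    ultimately have "(v has_derivative (\<lambda>h. ((?n + 1) *\<^sub>R c x) \<bullet> h)) (at x)"
      using has_derivative_sandwich[OF _ _ g'] by blast
    then show ?thesis by (simp add: gderiv_def inner_commute)
  qed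
  ultimately show ?thesis by blast
qed

end
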